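(* Let $E$ be a separable Banach space, let $(f_n)_n$ be a sequence of $\mathbb{T}\otimes\mathcal{B}(E)$-measurable integrands $f_n:\Omega\times E\to\overline{\mathbb{R}}$, let $(\mathcal{X},\mathcal{T})$ be a topological space with $\mathcal{X}\subset L_0(\Omega,E)$, and let $x\in\mathcal{X}$ be such that every sequence of $\mathcal{X}$ which $\mathcal{T}$-converges to $x$ converges to $x$ in the Biting sense. Let $f=seq\,\sigma\text{-}li_e f_n$. If $(x_n)_n$ is a Nagumo tight sequence in $\mathcal{X}$ which $\mathcal{T}$-converges to $x$ and satisfies the boundedness property with respect to $(f_n)_n$, then $$\liminf_n I_{f_n}(x_n)\ \ge\ I_{f^{**}}(x)-\delta^{+}\big((-f_n(x_n))_n\big).$$
   Context: $(\Omega,\mathbb{T},\mu)$ is a measure space with $\mu$ a $\sigma$-finite positive measure and $\mathbb{T}$ a $\mu$-complete $\sigma$-algebra. $L_0(\Omega,E)$ is the space of classes (for a.e. equality) of measurable functions $\Omega\to E$. An integrand is a function $f:\Omega\times E\to\overline{\mathbb{R}}$; $f_\omega=f(\omega,\cdot)$; for $x\in L_0(\Omega,E)$, $f(x)$ is the function $\omega\mapsto f(\omega,x(\omega))$; $v^-=\max(-v,0)$. Upper integral: for $v:\Omega\to\overline{\mathbb{R}}$, $\int^*_\Omega v\,d\mu=\inf\{\int_\Omega u\,d\mu: u\in L_1(\Omega,\mathbb{R}),\ u\ge v \text{ a.e.}\}$, which equals $\int^* v^+-\int^* v^-$ with $+\infty-\infty=+\infty$ for measurable $v$. $I_f(x)=\int^*_\Omega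 f(x)\,d\mu$. $\sigma=\sigma(E,E^* )$ is the weak topology. The integrand $f=seq\,\sigma\text{-}li_e f_n$ is defined by $f(\omega,e)=\inf\{\liminf_n f_n(\omega,e_n): (e_n)_n \text{ in } E,\ e_n\to e \text{ weakly}\}$. $f^*(\omega,e^* )=\sup_{e\in E}(\langle e^*,e\rangle-f(\omega,e))$ for $e^*\in E^*$, and $f^{**}(\omega,e)=\sup_{e^*\in E^*}(\langle e^*,e\rangle-f^*(\omega,e^* ))$ for $e\in E$. Biting convergence: $(x_n)_n$ converges to $x$ in the Biting sense if there is an increasing covering (up to a negligible set) $(\Omega_k)_k$ of $\Omega$ by measurable sets such that, for all $k$, the restrictions $x_n|_{\Omega_k}$ converge to $x|_{\Omega_k}$ for the weak topology $\sigma(L_1(\Omega_k,E),L_1(\Omega_k,E)^* )$. A Nagumo integrand is a $\mathbb{T}\otimes\mathcal{B}(E)$-measurable non negative integrand $h$ such that for every $\omega$ and every $e^*\in E^*$ all sublevel sets of $e\mapsto h_\omega(e)-\langle e^*,e\rangle$ are weakly compact. A set (or sequence) $X\subset L_0(\Omega,E)$ is Nagumo tight if there is a Nagumo integrand $h$ with $\sup_{x\in X}\int_\Omega h(x)\,d\mu<\infty$. $(x_n)_n$ satisfies the boundedness property with respect to $(f_n)_n$ if there is $n_0$ such that $(f_n^-(x_n))_{n\ge n_0}$ is bounded in $L_1(\Omega,\mathbb{R})$. For a sequence $(u_n)_n$ of measurable $\overline{\mathbb{R}}$-valued functions, $\delta^+((u_n)_n)=\sup_{(S_k)_k}\limsup_k\sup_{n\ge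 k}\int^*_{S_k}u_n\,d\mu$, the supremum being over all decreasing sequences $(S_k)_k$ of measurable sets with negligible intersection. *)

theory Defs
  imports "HOL-Analysis.Analysis"
begin

section \<open>Weak topologies\<close>

text \<open>The coarsest topology on the set \<open>A\<close> for which all real functions in \<open>\<Phi>\<close> are continuous.\<close>

definition initial_topology :: "'a set \<Rightarrow> ('a \<Rightarrow> real) set \<Rightarrow> 'a topology" where
  "initial_topology A \<Phi> = topology_generated_by {A \<inter> \<phi> -` U | \<phi> U. \<phi> \<in> \<Phi> \<and> open U}"

lemma topspace_initial_topology:
  assumes "\<Phi> \<noteq> {}"
  shows "topspace (initial_topology A \<Phi>) = A"
proof -
  obtain \<phi> where "\<phi> \<in> \<Phi>" using assms by blast
  then have "A \<in> {A \<inter> \<phi> -` U | \<phi> U. \<phi> \<in> \<Phi> \<and> open U}"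
    by (intro CollectI exI[of _ \<phi>] exI[of _ UNIV]) auto
  then show ?thesis
    unfolding initial_topology_def topology_generated_by_topspace by blast
qed

lemma limitin_initial_topology:
  assumes "\<Phi> \<noteq> {}"
  shows "limitin (initial_topology A \<Phi>) s l F \<longleftrightarrow>
    l \<in> A \<and> (\<forall>\<^sub>F n in F. s n \<in> A) \<and> (\<forall>\<phi>\<in>\<Phi>. ((\<lambda>n. \<phi> (s n)) \<longlongrightarrow> \<phi> l) F)"
  (is "?L \<longleftrightarrow> ?R")
proof
  have sub: "openin (initial_topology A \<Phi>) (A \<inter> \<phi> -` U)" if "\<phi> \<in> \<Phi>" "open U" for \<phi> U
    unfolding initial_topology_def using that by (intro topology_generated_by_Basis) blast
  assume L: ?L
  then have l: "l \<in> A"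
    by (simp add: limitin_def topspace_initial_topology[OF assms])
  have ev: "\<forall>\<^sub>F n in F. s n \<in> A \<and> \<phi> (s n) \<in> U" if "\<phi> \<in> \<Phi>" "open U" "\<phi> l \<in> U" for \<phi> U
  proof -
    have "\<forall>\<^sub>F n in F. s n \<in> A \<inter> \<phi> -` U"
      using L sub[OF that(1,2)] l that(3) unfolding limitin_def by auto
    then show ?thesis by simp
  qed
  obtain \<phi> where "\<phi> \<in> \<Phi>" using assms by blast
  from ev[OF this open_UNIV] have "\<forall>\<^sub>F n in F. s n \<in> A" by simp
  moreover have "((\<lambda>n. \<phi> (s n)) \<longlongrightarrow> \<phi> l) F" if "\<phi> \<in> \<Phi>" for \<phi>
  proof (rule topological_tendstoI)
    fix U assume "open U" "\<phi> l \<in> U"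
    from ev[OF that this] show "\<forall>\<^sub>F n in F. \<phi> (s n) \<in> U" by (rule eventually_mono) simp
  qed
  ultimately show ?R using l by blast
next
  assume R: ?R
  have "\<forall>\<^sub>F n in F. s n \<in> V"
    if "generate_topology_on {A \<inter> \<phi> -` U | \<phi> U. \<phi> \<in> \<Phi> \<and> open U} V" "l \<in> V" for V
    using that
  proof (induction rule: generate_topology_on.induct)
    case Empty
    then show ?case by simp
  next
    case (Int a b)
    then show ?case by (simp add: eventually_conj)
  next
    case (UN K)
    then obtain k where "k \<in> K" "l \<in> k" by blast
    with UN have "\<forall>\<^sub>F n in F. s n \<in> k" by blast
    then show ?case by (rule eventually_mono) (use \<open>k \<in> K\<close> in blast)
  next
    case (Basis V)
    then obtain \<phi> U where *: "V = A \<inter> \<phi> -` U" "\<phi> \<in> \<Phi>" "open U" by blast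
    then have "\<forall>\<^sub>F n in F. \<phi> (s n) \<in> U"
      using R Basis by (intro topological_tendstoD) auto
    with R have "\<forall>\<^sub>F n in F. s n \<in> A \<and> \<phi> (s n) \<in> U" by (simp add: eventually_conj)
    then show ?case by (rule eventually_mono) (simp add: *)
  qed
  with R show ?L
    unfolding limitin_def topspace_initial_topology[OF assms]
    by (auto simp: initial_topology_def openin_topology_generated_by_iff)
qed

definition weak_topology :: "'e::real_normed_vector topology" where
  "weak_topology = initial_topology UNIV (range (blinfun_apply :: ('e \<Rightarrow>\<^sub>L real) \<Rightarrow> 'e \<Rightarrow> real))"

section \<open>Weak convergence in \<open>L\<^sub>1\<close> and Biting convergence\<close>

text \<open>\<open>L\<^sub>1(N,E)\<close> is represented by the integrable functions themselves. The boundedness condition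
  makes every element of the dual constant on classes of a.e. equal functions.\<close>

definition L1_dual :: "'w measure \<Rightarrow> (('w \<Rightarrow> 'e::{banach, second_countable_topology}) \<Rightarrow> real) set" where
  "L1_dual N = {\<Lambda>.
     (\<forall>u v. integrable N u \<longrightarrow> integrable N v \<longrightarrow> \<Lambda> (\<lambda>\<omega>. u \<omega> + v \<omega>) = \<Lambda> u + \<Lambda> v) \<and>
     (\<forall>c u. integrable N u \<longrightarrow> \<Lambda> (\<lambda>\<omega>. c *\<^sub>R u \<omega>) = c * \<Lambda> u) \<and>
     (\<exists>C. \<forall>u. integrable N u \<longrightarrow> \<bar>\<Lambda> u\<bar> \<le> C * (\<integral>\<omega>. norm (u \<omega>) \<partial>N))}"

definition weak_L1_topology ::
    "'w measure \<Rightarrow> ('w \<Rightarrow> 'e::{banach, second_countable_topology}) topology" where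
  "weak_L1_topology N = initial_topology {u. integrable N u} (L1_dual N)"

definition weakly_converges_L1 ::
    "'w measure \<Rightarrow> (nat \<Rightarrow> 'w \<Rightarrow> 'e::{banach, second_countable_topology}) \<Rightarrow> ('w \<Rightarrow> 'e) \<Rightarrow> bool" where
  "weakly_converges_L1 N xs x \<longleftrightarrow>
     (\<forall>n. integrable N (xs n)) \<and> limitin (weak_L1_topology N) xs x sequentially"

definition biting_converges ::
    "'w measure \<Rightarrow> (nat \<Rightarrow> 'w \<Rightarrow> 'e::{banach, second_countable_topology}) \<Rightarrow> ('w \<Rightarrow> 'e) \<Rightarrow> bool" where
  "biting_converges M xs x \<longleftrightarrow>
     (\<exists>\<Omega>. (\<forall>k. \<Omega> k \<in> sets M) \<and> incseq \<Omega> \<and> space M - (\<Union>k. \<Omega> k) \<in> null_sets M \<and>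
        (\<forall>k::nat. weakly_converges_L1 (restrict_space M (\<Omega> k)) xs x))"

section \<open>The space \<open>L\<^sub>0\<close>\<close>

definition ae_class :: "'w measure \<Rightarrow> ('w \<Rightarrow> 'e::topological_space) \<Rightarrow> ('w \<Rightarrow> 'e) set" where
  "ae_class M x = {y \<in> borel_measurable M. AE \<omega> in M. y \<omega> = x \<omega>}"

definition L0 :: "'w measure \<Rightarrow> ('w \<Rightarrow> 'e::topological_space) set set" where
  "L0 M = ae_class M ` borel_measurable M"

section \<open>Upper integrals\<close>

definition upper_integral :: "'w measure \<Rightarrow> ('w \<Rightarrow> ereal) \<Rightarrow> ereal" where
  "upper_integral M v =
     Inf {ereal (\<integral>\<omega>. u \<omega> \<partial>M) | u. integrable M u \<and> (AE \<omega> in M. v \<omega> \<le> ereal (u \<omega>))}"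

definition integral_functional ::
    "'w measure \<Rightarrow> ('w \<Rightarrow> 'e \<Rightarrow> ereal) \<Rightarrow> ('w \<Rightarrow> 'e) \<Rightarrow> ereal" where
  "integral_functional M f x = upper_integral M (\<lambda>\<omega>. f \<omega> (x \<omega>))"

definition delta_plus :: "'w measure \<Rightarrow> (nat \<Rightarrow> 'w \<Rightarrow> ereal) \<Rightarrow> ereal" where
  "delta_plus M u =
     (SUP S \<in> {S :: nat \<Rightarrow> 'w set. (\<forall>k. S k \<in> sets M) \<and> decseq S \<and> (\<Inter>k. S k) \<in> null_sets M}.
        limsup (\<lambda>k. SUP n\<in>{k..}. upper_integral (restrict_space M (S k)) (u n)))"

section \<open>Integrands\<close>

definition measurable_integrand ::
    "'w measure \<Rightarrow> ('w \<Rightarrow> 'e::topological_space \<Rightarrow> ereal) \<Rightarrow> bool" where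
  "measurable_integrand M f \<longleftrightarrow> (\<lambda>(\<omega>, e). f \<omega> e) \<in> borel_measurable (M \<Otimes>\<^sub>M borel)"

definition seq_weak_li ::
    "(nat \<Rightarrow> 'w \<Rightarrow> 'e::real_normed_vector \<Rightarrow> ereal) \<Rightarrow> 'w \<Rightarrow> 'e \<Rightarrow> ereal" where
  "seq_weak_li f \<omega> e =
     Inf {liminf (\<lambda>n. f n \<omega> (es n)) | es. limitin weak_topology es e sequentially}"

definition conjugate ::
    "('w \<Rightarrow> 'e::real_normed_vector \<Rightarrow> ereal) \<Rightarrow> 'w \<Rightarrow> ('e \<Rightarrow>\<^sub>L real) \<Rightarrow> ereal" where
  "conjugate f \<omega> \<phi> = (SUP e. ereal (blinfun_apply \<phi> e) - f \<omega> e)"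

definition biconjugate ::
    "('w \<Rightarrow> 'e::real_normed_vector \<Rightarrow> ereal) \<Rightarrow> 'w \<Rightarrow> 'e \<Rightarrow> ereal" where
  "biconjugate f \<omega> e = (SUP \<phi>. ereal (blinfun_apply \<phi> e) - conjugate f \<omega> \<phi>)"

definition nagumo_integrand ::
    "'w measure \<Rightarrow> ('w \<Rightarrow> 'e::real_normed_vector \<Rightarrow> ereal) \<Rightarrow> bool" where
  "nagumo_integrand M h \<longleftrightarrow>
     measurable_integrand M h \<and>
     (\<forall>\<omega>\<in>space M. \<forall>e. 0 \<le> h \<omega> e) \<and>
     (\<forall>\<omega>\<in>space M. \<forall>\<phi> :: 'e \<Rightarrow>\<^sub>L real. \<forall>r::real.
        compactin weak_topology {e. h \<omega> e - ereal (blinfun_apply \<phi> e) \<le> ereal r})"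

definition nagumo_tight ::
    "'w measure \<Rightarrow> ('w \<Rightarrow> 'e::real_normed_vector) set \<Rightarrow> bool" where
  "nagumo_tight M X \<longleftrightarrow>
     (\<exists>h. nagumo_integrand M h \<and> (SUP x\<in>X. \<integral>\<^sup>+\<omega>. e2ennreal (h \<omega> (x \<omega>)) \<partial>M) < \<infinity>)"

definition boundedness_property ::
    "'w measure \<Rightarrow> (nat \<Rightarrow> 'w \<Rightarrow> 'e \<Rightarrow> ereal) \<Rightarrow> (nat \<Rightarrow> 'w \<Rightarrow> 'e) \<Rightarrow> bool" where
  "boundedness_property M f xs \<longleftrightarrow>
     (\<exists>n0. (SUP n\<in>{n0..}. \<integral>\<^sup>+\<omega>. e2ennreal (max (- f n \<omega> (xs n \<omega>)) 0) \<partial>M) < \<infinity>)"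

end

theory Submission
  imports Defs "HOL-Library.Function_Algebras"
begin

text \<open>
The obstruction to lower semicontinuity is that the negative parts of \<open>v\<^sub>n = f\<^sub>n(x\<^sub>n)\<close> may
concentrate on small sets, and \<open>\<delta>\<^sup>+\<close> measures the mass lost in this way. Suppose the integrals of
\<open>v\<^sub>n\<close> are below \<open>a\<close> along a subsequence. A biting argument (\<open>biting_truncation\<close>) refines it
and provides measurable sets \<open>S\<^sub>n\<close>, decreasing to a null set, outside of which the negative
parts \<open>u\<^sub>n\<close> are uniformly integrable: the integral of \<open>u\<^sub>n\<close> over the part of the complement of \<open>S\<^sub>n\<close>
with \<open>u\<^sub>n > q w\<close> is small for large \<open>q\<close>, where \<open>w > 0\<close> is a fixed integrable function. By the
definition of \<open>\<delta>\<^sup>+\<close>, deleting \<open>v\<^sub>n\<close> on \<open>S\<^sub>n\<close> increases the integral by at most \<open>\<delta>\<^sup>+\<close> plus a vanishing error.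

Biting convergence enters through Mazur's lemma: convex combinations of tails of \<open>(x\<^sub>n)\<close> converge to
\<open>x\<close> in norm almost everywhere (\<open>biting_converges_convex_combinations\<close>). What remains is pointwise. Let
\<open>Z\<^sub>n\<close> be \<open>v\<^sub>n\<close> set to zero on \<open>S\<^sub>n\<close>, plus the penalty \<open>\<eta> h(x\<^sub>n)\<close>, plus \<open>u\<^sub>n\<close> where \<open>u\<^sub>n > q w\<close> off \<open>S\<^sub>n\<close>.
For every \<open>\<phi>\<close> in the dual and every \<open>r > f\<^sup>*(\<omega>,\<phi>)\<close> the inequality \<open>\<phi>(x\<^sub>n(\<omega>)) - r \<le> Z\<^sub>n(\<omega>)\<close> holds
for all large \<open>n\<close> (\<open>eventually_affine_le_penalized\<close>): while \<open>h(\<omega>,x\<^sub>n(\<omega>))\<close> is bounded, \<open>x\<^sub>n(\<omega>)\<close> stays in a weakly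
compact, hence sequentially weakly compact set, and the definition of the sequential lower limit
applies; while it is large, the penalty dominates everything else, because
\<open>h\<close> grows faster than every multiple of \<open>\<phi>\<close>. Since this comparison holds term by
term, it survives convex combinations, and with these converging to \<open>x\<close>,
\<open>f\<^sup>*\<^sup>*(x)\<close> is at most the lower limit of the convex combinations of the \<open>Z\<^sub>n\<close>.

Finally \<open>Z\<^sub>n \<ge> - q w\<close>, so Fatou's lemma bounds the upper integral of \<open>f\<^sup>*\<^sup>*(x)\<close> by the upper limit of
the integrals of \<open>Z\<^sub>n\<close>, which is at most \<open>a + \<delta>\<^sup>+\<close> up to an arbitrarily small error.

Both Mazur's lemma and the countable family of separating functionals behind sequential weak
compactness come from one separation lemma (\<open>seminorm_separation\<close>), which follows from the fact that
minimal sublinear functionals are linear.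
\<close>

section \<open>Separation by linear functionals\<close>

definition sublinear :: "('v::real_vector \<Rightarrow> real) \<Rightarrow> bool" where
  "sublinear q \<longleftrightarrow> (\<forall>x y. q (x + y) \<le> q x + q y) \<and> (\<forall>c x. 0 \<le> c \<longrightarrow> q (c *\<^sub>R x) \<le> c * q x)"

lemma sublinearD:
  assumes "sublinear q"
  shows "q (x + y) \<le> q x + q y" "0 \<le> c \<Longrightarrow> q (c *\<^sub>R x) \<le> c * q x"
  using assms by (auto simp: sublinear_def)

lemma sublinear_zero: "sublinear q \<Longrightarrow> q 0 = 0"
  using sublinearD(1)[of q 0 0] sublinearD(2)[of q 0 0] by simp

lemma sublinear_scale:
  assumes "sublinear q" "0 \<le> c"
  shows "q (c *\<^sub>R x) = c * q x"
proof (cases "c = 0")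
  case True
  then show ?thesis using sublinear_zero[OF assms(1)] by simp
next
  case False
  have "q (inverse c *\<^sub>R (c *\<^sub>R x)) \<le> inverse c * q (c *\<^sub>R x)"
    using assms by (intro sublinearD) auto
  then have "c * q x \<le> q (c *\<^sub>R x)" using False assms(2) by (simp add: field_simps)
  then show ?thesis using sublinearD(2)[OF assms] by (simp add: order_antisym)
qed

lemma sublinear_lower: "sublinear q \<Longrightarrow> - q (- x) \<le> q x"
  using sublinearD(1)[of q x "- x"] sublinear_zero[of q] by simp

text \<open>Every sublinear \<open>q \<le> p\<close> satisfies \<open>- p (- x) \<le> q x\<close>, so the pointwise infimum of a chain is finite; it
stays subadditive because of two members of a chain the smaller one bounds both summands. This
is the chain condition of Zorn's lemma for the sublinear functionals below \<open>p\<close>.\<close>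

lemma sublinear_INF_chain:
  fixes p :: "'v::real_vector \<Rightarrow> real"
  assumes "C \<noteq> {}" and sub: "\<And>q. q \<in> C \<Longrightarrow> sublinear q" and le: "\<And>q. q \<in> C \<Longrightarrow> q \<le> p"
    and chain: "\<And>q q'. q \<in> C \<Longrightarrow> q' \<in> C \<Longrightarrow> q \<le> q' \<or> q' \<le> q"
  shows "sublinear (\<lambda>x. INF q\<in>C. q x)" and "\<And>q x. q \<in> C \<Longrightarrow> (INF q\<in>C. q x) \<le> q x"
proof -
  have bdd: "bdd_below ((\<lambda>q. q x) ` C)" for x
  proof (rule bdd_belowI2)
    fix q assume "q \<in> C"
    then show "- p (- x) \<le> q x"
      using sublinear_lower[OF sub, of q x] le[of q] by (auto simp: le_fun_def dest: spec[of _ "- x"])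
  qed
  show low: "(INF q\<in>C. q x) \<le> q x" if "q \<in> C" for q x
    by (rule cINF_lower[OF bdd that])
  let ?u = "\<lambda>x. INF q\<in>C. q x"
  have add: "?u (x + y) \<le> ?u x + ?u y" for x y
  proof -
    have "?u (x + y) - q' y \<le> q x" if "q \<in> C" "q' \<in> C" for q q'
      using chain[OF that]
    proof
      assume "q \<le> q'"
      then show ?thesis
        using low[OF that(1), of "x + y"] sublinearD(1)[OF sub[OF that(1)], of x y] 
        by (auto simp: le_fun_def dest: spec[of _ y])
    next
      assume "q' \<le> q"
      then show ?thesis
        using low[OF that(2), of "x + y"] sublinearD(1)[OF sub[OF that(2)], of x y] 
        by (auto simp: le_fun_def dest: spec[of _ x])
    qed
    then have "?u (x + y) - q' y \<le> ?u x" if "q' \<in> C" for q'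
      using that \<open>C \<noteq> {}\<close> by (intro cINF_greatest) auto
    then have "?u (x + y) - ?u x \<le> ?u y"
      using \<open>C \<noteq> {}\<close> by (intro cINF_greatest) (auto simp: algebra_simps)
    then show ?thesis by simp
  qed
  have scale: "?u (c *\<^sub>R x) \<le> c * ?u x" if "0 \<le> c" for c x
  proof (cases "c = 0")
    case True
    have "?u 0 \<le> 0" using \<open>C \<noteq> {}\<close> low sublinear_zero[OF sub] by (metis ex_in_conv)
    then show ?thesis using True by simp
  next
    case False
    have "?u (c *\<^sub>R x) / c \<le> ?u x"
    proof (rule cINF_greatest[OF \<open>C \<noteq> {}\<close>])
      fix q assume "q \<in> C"
      from low[OF this, of "c *\<^sub>R x"] sublinear_scale[OF sub[OF this] that, of x] False that
      show "?u (c *\<^sub>R x) / c \<le> q x" by (simp add: field_simps)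
    qed
    then show ?thesis using False that by (simp add: field_simps)
  qed
  show "sublinear ?u" using add scale by (simp add: sublinear_def)
qed

text \<open>The greatest sublinear functional below \<open>q\<close> whose value at \<open>- y\<close> is \<open>- q y\<close>. If \<open>q\<close> is minimal, this
functional is \<open>q\<close> itself, and the bound at \<open>t = 1\<close> turns into superadditivity of \<open>q\<close>.\<close>

lemma sublinear_directional:
  assumes q: "sublinear q"
  shows "sublinear (\<lambda>x. INF t\<in>{0..}. q (x + t *\<^sub>R y) - t * q y)" (is "sublinear ?r")
    and "\<And>x t. 0 \<le> t \<Longrightarrow> (INF t\<in>{0..}. q (x + t *\<^sub>R y) - t * q y) \<le> q (x + t *\<^sub>R y) - t * q y"
proof -
  have bdd: "bdd_below ((\<lambda>t. q (x + t *\<^sub>R y) - t * q y) ` {0..})" for x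
  proof (rule bdd_belowI2)
    fix t :: real assume "t \<in> {0..}"
    then show "- q (- x) \<le> q (x + t *\<^sub>R y) - t * q y"
      using sublinear_scale[OF q, of t y] sublinearD(1)[OF q, of "x + t *\<^sub>R y" "- x"] by simp
  qed
  show low: "?r x \<le> q (x + t *\<^sub>R y) - t * q y" if "0 \<le> t" for x t
    by (rule cINF_lower[OF bdd]) (use that in simp)
  have add: "?r (x + x') \<le> ?r x + ?r x'" for x x'
  proof -
    have "?r (x + x') - (q (x' + t' *\<^sub>R y) - t' * q y) \<le> q (x + t *\<^sub>R y) - t * q y"
      if "0 \<le> t" "0 \<le> t'" for t t'
      using low[of "t + t'" "x + x'"] sublinearD(1)[OF q, of "x + t *\<^sub>R y" "x' + t' *\<^sub>R y"] that
      by (simp add: algebra_simps)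
    then have "?r (x + x') - (q (x' + t' *\<^sub>R y) - t' * q y) \<le> ?r x" if "0 \<le> t'" for t'
      using that by (intro cINF_greatest) auto
    then have "?r (x + x') - ?r x \<le> ?r x'"
      by (intro cINF_greatest) (auto simp: algebra_simps)
    then show ?thesis by simp
  qed
  have scale: "?r (c *\<^sub>R x) \<le> c * ?r x" if "0 \<le> c" for c x
  proof (cases "c = 0")
    case True
    have "?r 0 \<le> 0" using low[of 0 0] sublinear_zero[OF q] by simp
    then show ?thesis using True by simp
  next
    case False
    have "?r (c *\<^sub>R x) / c \<le> ?r x"
    proof (rule cINF_greatest)
      fix t :: real assume "t \<in> {0..}"
      with low[of "c * t" "c *\<^sub>R x"] sublinear_scale[OF q that, of "x + t *\<^sub>R y"] False that
      show "?r (c *\<^sub>R x) / c \<le> q (x + t *\<^sub>R y) - t * q y" 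
        by (simp add: field_simps scaleR_add_right)
    qed simp
    then show ?thesis using False that by (simp add: field_simps)
  qed
  show "sublinear ?r" using add scale by (simp add: sublinear_def)
qed

text \<open>The Hahn--Banach theorem in its leanest form: a minimal sublinear functional is also
superadditive, hence linear, and minimal ones exist by Zorn's lemma.\<close>

lemma linear_below_sublinear:
  fixes p :: "'v::real_vector \<Rightarrow> real"
  assumes p: "sublinear p"
  obtains l where "linear l" "l \<le> p"
proof -
  let ?A = "{q. sublinear q \<and> q \<le> p}"
  have "\<exists>m\<in>?A. \<forall>a\<in>?A. a \<le> m \<longrightarrow> a = m"
  proof (rule predicate_Zorn[of ?A "\<lambda>m a. a \<le> m"])
    show "partial_order_on ?A (relation_of (\<lambda>m a. a \<le> m) ?A)"
      by (rule partial_order_on_relation_ofI) auto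
    fix C assume "C \<in> Chains (relation_of (\<lambda>m a. a \<le> m) ?A)"
    then have C: "C \<subseteq> ?A" "\<And>a b. a \<in> C \<Longrightarrow> b \<in> C \<Longrightarrow> a \<le> b \<or> b \<le> a"
      unfolding Chains_def relation_of_def by auto
    show "\<exists>u\<in>?A. \<forall>a\<in>C. u \<le> a"
    proof (cases "C = {}")
      case True
      then show ?thesis using p by auto
    next
      case False
      have sub: "\<And>q. q \<in> C \<Longrightarrow> sublinear q" and le: "\<And>q. q \<in> C \<Longrightarrow> q \<le> p" using C(1) by auto
      note * = sublinear_INF_chain[of C p, OF False sub le C(2)]
      have "(\<lambda>x. INF q\<in>C. q x) \<in> ?A"
      proof -
        obtain q where "q \<in> C" using False by blast
        then have "(\<lambda>x. INF q\<in>C. q x) \<le> q" using *(2) by (auto simp: le_fun_def)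
        moreover have "q \<le> p" using C \<open>q \<in> C\<close> by auto
        ultimately show ?thesis using *(1) by auto
      qed
      moreover have "\<forall>a\<in>C. (\<lambda>x. INF q\<in>C. q x) \<le> a" using *(2) by (auto simp: le_fun_def)
      ultimately show ?thesis by blast
    qed
  qed
  then obtain q where q: "sublinear q" "q \<le> p" 
    and min: "\<And>r. sublinear r \<Longrightarrow> r \<le> q \<Longrightarrow> r = q" by force
  have super: "q x + q y \<le> q (x + y)" for x y
  proof -
    let ?r = "\<lambda>x. INF t\<in>{0..}. q (x + t *\<^sub>R y) - t * q y"
    have "?r \<le> q" using sublinear_directional(2)[OF q(1), of 0 _ y] by (simp add: le_fun_def)
    from min[OF sublinear_directional(1)[OF q(1)] this] have "?r x = q x" by (rule fun_cong)
    then show ?thesis using sublinear_directional(2)[OF q(1), of 1 x y] by simp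
  qed
  have add: "q (x + y) = q x + q y" for x y
    using super sublinearD(1)[OF q(1)] by (rule order_antisym[rotated])
  have "q (- x) = - q x" for x using add[of x "- x"] sublinear_zero[OF q(1)] by simp
  then have "q (c *\<^sub>R x) = c * q x" for c x
    using sublinear_scale[OF q(1), of c x] sublinear_scale[OF q(1), of "- c" x] by (cases "0 \<le> c") auto
  with add have "linear q" by (intro linearI) auto
  then show ?thesis using that q(2) by blast
qed

text \<open>Separation of a convex set from the origin with a sharp constant. The functional
\<open>p x = inf {N (x + t c) - t d | t \<ge> 0, c \<in> C}\<close> is sublinear because \<open>C\<close> is convex, lies below \<open>N\<close>
(take \<open>t = 0\<close>) and satisfies \<open>p (- c) \<le> - d\<close> (take \<open>t = 1\<close>), so any linear functional below \<open>p\<close> will do.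
With \<open>C\<close> a single point this yields norming functionals, with \<open>C\<close> a convex hull it yields Mazur's
lemma. The subspace \<open>V\<close> serves for seminorms that make sense only on part of the space, such as
the \<open>L\<^sub>1\<close> seminorm on functions; composing with a linear projection onto \<open>V\<close> removes it.\<close>

lemma seminorm_separation:
  fixes N :: "'v::real_vector \<Rightarrow> real"
  assumes V: "subspace V"
    and tri: "\<And>x y. x \<in> V \<Longrightarrow> y \<in> V \<Longrightarrow> N (x + y) \<le> N x + N y"
    and hom: "\<And>c x. x \<in> V \<Longrightarrow> N (c *\<^sub>R x) = \<bar>c\<bar> * N x"
    and C: "convex C" "C \<noteq> {}" "C \<subseteq> V" and d: "\<And>c. c \<in> C \<Longrightarrow> d \<le> N c"
  obtains l where "linear l" "\<And>x. x \<in> V \<Longrightarrow> \<bar>l x\<bar> \<le> N x" "\<And>c. c \<in> C \<Longrightarrow> d \<le> l c"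
proof -
  obtain P :: "'v \<Rightarrow> 'v" where P: "range P \<subseteq> V" "linear P" "\<And>v. v \<in> V \<Longrightarrow> P v = v"
    using linear_exists_left_inverse_on[OF linear_id V] by auto
  define S where "S x = N (P x)" for x
  have PV: "P x \<in> V" for x using P(1) by auto
  have S_tri: "S (x + y) \<le> S x + S y" for x y
    unfolding S_def using tri[OF PV PV] linear_add[OF P(2)] by simp
  have S_hom: "S (c *\<^sub>R x) = \<bar>c\<bar> * S x" for c x
    unfolding S_def using hom[OF PV] linear_scale[OF P(2)] by simp
  have S_V: "S x = N x" if "x \<in> V" for x using P(3)[OF that] by (simp add: S_def)
  define I where "I = {0::real..} \<times> C"
  define g where "g x = (\<lambda>(t, c). S (x + t *\<^sub>R c) - t * d)" for x
  have I: "I \<noteq> {}" using C by (auto simp: I_def)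
  have lowg: "- S x \<le> g x i" if "i \<in> I" for x i
  proof -
    obtain t c where i: "i = (t, c)" "0 \<le> t" "c \<in> C" using \<open>i \<in> I\<close> unfolding I_def by auto
    have "t * d \<le> S (t *\<^sub>R c)" using i C d S_V S_hom by (auto intro!: mult_left_mono)
    moreover have "S (t *\<^sub>R c) \<le> S (x + t *\<^sub>R c) + S x"
      using S_tri[of "x + t *\<^sub>R c" "(-1) *\<^sub>R x"] S_hom[of "-1" x] by simp
    ultimately show ?thesis by (simp add: g_def i)
  qed
  have bdd: "bdd_below (g x ` I)" for x by (rule bdd_belowI2) (rule lowg)
  define p where "p x = (INF i\<in>I. g x i)" for x
  have low: "p x \<le> g x i" if "i \<in> I" for x i
    unfolding p_def by (rule cINF_lower[OF bdd that])
  have add: "p (x + y) \<le> p x + p y" for x y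
  proof -
    have key: "p (x + y) \<le> g x i + g y j" if ij: "i \<in> I" "j \<in> I" for i j
    proof -
      obtain t c where i: "i = (t, c)" "0 \<le> t" "c \<in> C" using ij unfolding I_def by auto
      obtain s b where j: "j = (s, b)" "0 \<le> s" "b \<in> C" using ij unfolding I_def by auto
      \<comment> \<open>Convexity of \<open>C\<close> merges two competitors; when \<open>t = s = 0\<close> any point of \<open>C\<close> serves.\<close>
      obtain a where a: "a \<in> C" "t *\<^sub>R c + s *\<^sub>R b = (t + s) *\<^sub>R a"
      proof (cases "t + s = 0")
        case True
        then have "t = 0" "s = 0" using i j by auto
        then show ?thesis using that[of c] i by simp
      next
        case False
        then have pos: "t + s > 0" using i j by simp
        have "(t / (t + s)) *\<^sub>R c + (s / (t + s)) *\<^sub>R b \<in> C"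
          using i j pos by (intro convexD[OF C(1)]) (auto simp: add_divide_distrib[symmetric])
        then show ?thesis using that pos by (simp add: scaleR_add_right)
      qed
      have "p (x + y) \<le> g (x + y) (t + s, a)" using a i j by (intro low) (simp add: I_def)
      also have "\<dots> = S ((x + t *\<^sub>R c) + (y + s *\<^sub>R b)) - (t + s) * d"
      proof -
        have "(x + y) + (t + s) *\<^sub>R a = (x + y) + (t *\<^sub>R c + s *\<^sub>R b)" by (simp only: a(2))
        also have "\<dots> = (x + t *\<^sub>R c) + (y + s *\<^sub>R b)" by (simp only: add_ac)
        finally show ?thesis by (simp only: g_def prod.case)
      qed
      also have "\<dots> \<le> g x i + g y j"
        using S_tri[of "x + t *\<^sub>R c" "y + s *\<^sub>R b"] by (simp add: g_def i j algebra_simps)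
      finally show ?thesis .
    qed
    have "p (x + y) - g y j \<le> p x" if "j \<in> I" for j
      unfolding p_def[of x] using key[OF _ that] by (intro cINF_greatest[OF I]) (simp add: algebra_simps)
    then have "p (x + y) - p x \<le> p y"
      unfolding p_def[of y] by (intro cINF_greatest[OF I]) (simp add: algebra_simps)
    then show ?thesis by simp
  qed
  have p_le: "p x \<le> S x" for x
    using low[of "(0, _)" x] C(2) by (auto simp: I_def g_def)
  have scale: "p (c *\<^sub>R x) \<le> c * p x" if "0 \<le> c" for c x
  proof (cases "c = 0")
    case True
    then show ?thesis using p_le[of 0] S_hom[of 0 0] by simp
  next
    case False
    have "p (c *\<^sub>R x) / c \<le> p x"
      unfolding p_def[of x]
    proof (rule cINF_greatest[OF I])
      fix i assume "i \<in> I"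
      then obtain t b where i: "i = (t, b)" "0 \<le> t" "b \<in> C" unfolding I_def by auto
      have "p (c *\<^sub>R x) \<le> g (c *\<^sub>R x) (c * t, b)" using i that by (intro low) (simp add: I_def)
      also have "\<dots> = S (c *\<^sub>R (x + t *\<^sub>R b)) - (c * t) * d"
        by (simp add: g_def scaleR_add_right)
      also have "\<dots> = c * g x i" unfolding S_hom using that by (simp add: g_def i algebra_simps)
      finally show "p (c *\<^sub>R x) / c \<le> g x i" using False that by (simp add: field_simps)
    qed
    then show ?thesis using False that by (simp add: field_simps)
  qed
  have "sublinear p" using add scale by (simp add: sublinear_def)
  then obtain l where l: "linear l" "l \<le> p" by (rule linear_below_sublinear)
  then have lS: "l x \<le> S x" for x using p_le[of x] by (auto simp: le_fun_def intro: order_trans)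
  show ?thesis
  proof (rule that[OF l(1)])
    fix x assume "x \<in> V"
    then show "\<bar>l x\<bar> \<le> N x"
      using lS[of x] lS[of "- x"] S_V S_hom[of "-1" x] linear_neg[OF l(1), of x] by auto
  next
    fix c assume c: "c \<in> C"
    then have "l (- c) \<le> g (- c) (1, c)" using l(2) low[of "(1, c)" "- c"] 
      by (auto simp: le_fun_def I_def intro: order_trans)
    then show "d \<le> l c" using linear_neg[OF l(1)] S_hom[of 0 0] by (simp add: g_def)
  qed
qed

section \<open>Weak sequential compactness and lower limits of integrands\<close>

lemma frequently_subsequence:
  assumes "\<And>j. \<exists>\<^sub>F n in sequentially. P j n"
  obtains r :: "nat \<Rightarrow> nat" where "strict_mono r" "\<And>j. P j (r j)"
proof -
  have ex: "\<exists>n>m. P j n" for j m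
    using assms[of j] unfolding frequently_sequentially by (meson Suc_le_lessD)
  have "\<exists>r. \<forall>j. P j (r j) \<and> r j < r (Suc j)"
    by (rule dependent_nat_choice) (use ex in blast)+
  then obtain r where "\<And>j. P j (r j)" "\<And>j. r j < r (Suc j)" by blast
  then show ?thesis by (intro that[of r]) (auto simp: strict_mono_Suc_iff)
qed

lemma norming_functional:
  fixes d :: "'e::real_normed_vector"
  obtains \<phi> :: "'e \<Rightarrow>\<^sub>L real" where "\<And>x. \<bar>blinfun_apply \<phi> x\<bar> \<le> norm x" "norm d \<le> blinfun_apply \<phi> d"
proof -
  obtain l where l: "linear l" "\<And>x. \<bar>l x\<bar> \<le> norm x" "norm d \<le> l d"
    by (rule seminorm_separation[of UNIV norm "{d}" "norm d"]) (auto intro: norm_triangle_ineq)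
  have "bounded_linear l"
    by (rule bounded_linear_intro[of _ 1]) (use l in \<open>auto simp: linear_add linear_scale\<close>)
  then show ?thesis using that[of "Blinfun l"] l by (simp add: bounded_linear_Blinfun_apply)
qed

text \<open>Functionals that norm the points of a countable dense set separate points: if the one that norms
\<open>d\<close> vanishes at \<open>z\<close>, then \<open>norm d \<le> norm (d - z)\<close>, which fails for \<open>d\<close> close to \<open>z \<noteq> 0\<close>.\<close>

lemma countable_separating_functionals:
  obtains \<phi> :: "nat \<Rightarrow> ('e::{real_normed_vector, second_countable_topology} \<Rightarrow>\<^sub>L real)"
  where "\<And>x y. (\<And>i. blinfun_apply (\<phi> i) x = blinfun_apply (\<phi> i) y) \<Longrightarrow> x = y"
proof -
  obtain D :: "'e set" where D: "countable D" "\<And>X. open X \<Longrightarrow> X \<noteq> {} \<Longrightarrow> \<exists>d\<in>D. d \<in> X"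
    by (rule countable_dense_setE) blast
  have "D \<noteq> {}" using D(2)[of UNIV] by auto
  obtain \<psi> :: "'e \<Rightarrow> ('e \<Rightarrow>\<^sub>L real)" where
    psi: "\<And>d x. \<bar>blinfun_apply (\<psi> d) x\<bar> \<le> norm x" "\<And>d. norm d \<le> blinfun_apply (\<psi> d) d"
    using norming_functional by metis
  show ?thesis
  proof (rule that[of "\<lambda>i. \<psi> (from_nat_into D i)"], rule ccontr)
    fix x y :: 'e
    assume eq: "\<And>i. blinfun_apply (\<psi> (from_nat_into D i)) x = blinfun_apply (\<psi> (from_nat_into D i)) y"
      and "x \<noteq> y"
    define z where "z = x - y"
    have z: "norm z > 0" using \<open>x \<noteq> y\<close> by (simp add: z_def)
    then obtain d where d: "d \<in> D" "dist z d < norm z / 4"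
      using D(2)[of "ball z (norm z / 4)"] by auto
    then obtain i where "d = from_nat_into D i"
      using from_nat_into_surj[OF D(1)] by metis
    then have "blinfun_apply (\<psi> d) z = 0" using eq by (simp add: z_def blinfun.diff_right)
    then have "norm d \<le> norm (d - z)"
      using psi(2)[of d] psi(1)[of d "d - z"] by (simp add: blinfun.diff_right)
    moreover have "norm z \<le> norm d + norm (d - z)" using norm_triangle_ineq4[of d "d - z"] by simp
    ultimately show False using d(2) z by (simp add: dist_norm norm_minus_commute)
  qed
qed

lemma limitin_weak_topology:
  "limitin weak_topology es e F \<longleftrightarrow> (\<forall>\<phi> :: 'e::real_normed_vector \<Rightarrow>\<^sub>L real. ((\<lambda>n. blinfun_apply \<phi> (es n)) \<longlongrightarrow> blinfun_apply \<phi> e) F)"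
  unfolding weak_topology_def by (subst limitin_initial_topology) auto

lemma openin_weak_topology_vimage:
  fixes \<phi> :: "'e::real_normed_vector \<Rightarrow>\<^sub>L real"
  shows "open U \<Longrightarrow> openin weak_topology (blinfun_apply \<phi> -` U)"
  unfolding weak_topology_def initial_topology_def
  by (rule topology_generated_by_Basis) (auto intro!: exI[of _ "blinfun_apply \<phi>"])

text \<open>Otherwise the open sets that the sequence eventually leaves would cover \<open>K\<close>.\<close>

lemma compactin_cluster_point:
  fixes s :: "nat \<Rightarrow> 'a"
  assumes "compactin X K" and s: "\<And>n. s n \<in> K"
  shows "\<exists>e\<in>K. \<forall>U. openin X U \<longrightarrow> e \<in> U \<longrightarrow> (\<exists>\<^sub>F n in sequentially. s n \<in> U)"
proof (rule ccontr)
  assume not: "\<not> ?thesis"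
  let ?\<U> = "{U. openin X U \<and> (\<forall>\<^sub>F n in sequentially. s n \<notin> U)}"
  have "K \<subseteq> \<Union>?\<U>"
  proof
    fix e assume "e \<in> K"
    with not obtain U where "openin X U" "e \<in> U" "\<not> (\<exists>\<^sub>F n in sequentially. s n \<in> U)"
      by blast
    then show "e \<in> \<Union>?\<U>" by (auto simp: not_frequently)
  qed
  then obtain \<F> where \<F>: "finite \<F>" "\<F> \<subseteq> ?\<U>" "K \<subseteq> \<Union>\<F>"
    using compactinD[OF assms(1), of ?\<U>] by auto
  then have "\<forall>\<^sub>F n in sequentially. \<forall>U\<in>\<F>. s n \<notin> U"
    by (intro eventually_ball_finite) auto
  then show False using s \<F>(3) by (auto simp: eventually_sequentially)
qed

lemma weakly_compact_imp_bounded: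
  fixes \<phi> :: "'e::real_normed_vector \<Rightarrow>\<^sub>L real"
  assumes "compactin weak_topology K"
  obtains B where "\<And>e. e \<in> K \<Longrightarrow> \<bar>blinfun_apply \<phi> e\<bar> \<le> B"
proof -
  have "continuous_map weak_topology euclidean (blinfun_apply \<phi>)"
    unfolding continuous_map_openin_preimage_eq
    using openin_Int[OF openin_topspace openin_weak_topology_vimage] by auto
  then have "compact (blinfun_apply \<phi> ` K)"
    using image_compactin[OF assms] by fastforce
  from compact_imp_bounded[OF this] obtain B where "\<forall>e\<in>K. \<bar>blinfun_apply \<phi> e\<bar> \<le> B"
    by (auto simp: bounded_iff)
  then show ?thesis by (intro that[of B]) auto
qed

text \<open>The direction of the Eberlein--Smulian theorem that is needed, which separability makes
elementary. A subsequence is chosen along which countably many separating functionals converge to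
their values at a weak cluster point \<open>e\<close>. Every weak cluster point of every further subsequence then
has the same values, hence equals \<open>e\<close>, and compactness forces convergence of all functionals.\<close>

lemma weakly_compact_imp_seq_compact:
  fixes s :: "nat \<Rightarrow> 'e::{real_normed_vector, second_countable_topology}"
  assumes K: "compactin weak_topology K" and s: "\<And>n. s n \<in> K"
  obtains e r where "strict_mono r" "limitin weak_topology (s \<circ> r) e sequentially"
proof -
  obtain \<phi> :: "nat \<Rightarrow> ('e \<Rightarrow>\<^sub>L real)"
    where sep: "\<And>x y. (\<And>i. blinfun_apply (\<phi> i) x = blinfun_apply (\<phi> i) y) \<Longrightarrow> x = y"
    using countable_separating_functionals by blast
  from compactin_cluster_point[OF K, of s] s
  obtain e where e: "\<And>U. openin weak_topology U \<Longrightarrow> e \<in> U \<Longrightarrow> \<exists>\<^sub>F n in sequentially. s n \<in> U"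
    by auto
  have freq: "\<exists>\<^sub>F n in sequentially. \<forall>i\<le>j. dist (\<phi> i (s n)) (\<phi> i e) < inverse (real (Suc j))" for j
  proof -
    let ?U = "{y. \<forall>i\<le>j. dist (\<phi> i y) (\<phi> i e) < inverse (real (Suc j))}"
    have "openin weak_topology (\<Inter>i\<in>{..j}. \<phi> i -` ball (\<phi> i e) (inverse (real (Suc j))))"
      by (rule openin_Inter) (auto intro: openin_weak_topology_vimage)
    also have "(\<Inter>i\<in>{..j}. \<phi> i -` ball (\<phi> i e) (inverse (real (Suc j)))) = ?U"
      by (auto simp: dist_commute)
    finally show ?thesis using e[of ?U] by simp
  qed
  obtain r where r: "strict_mono r"
    "\<And>j. \<forall>i\<le>j. dist (\<phi> i (s (r j))) (\<phi> i e) < inverse (real (Suc j))"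
    by (rule frequently_subsequence[of "\<lambda>j n. \<forall>i\<le>j. dist (\<phi> i (s n)) (\<phi> i e) < inverse (real (Suc j))",
        OF freq]) simp
  have lim: "(\<lambda>j. \<phi> i (s (r j))) \<longlonglongrightarrow> \<phi> i e" for i
  proof (rule tendstoI)
    fix \<epsilon> :: real assume "0 < \<epsilon>"
    have "\<forall>\<^sub>F j in sequentially. inverse (real (Suc j)) < \<epsilon>"
      using order_tendstoD(2)[OF LIMSEQ_inverse_real_of_nat \<open>0 < \<epsilon>\<close>] .
    with eventually_ge_at_top[of i] show "\<forall>\<^sub>F j in sequentially. dist (\<phi> i (s (r j))) (\<phi> i e) < \<epsilon>"
      by eventually_elim (use r(2) in \<open>meson less_trans\<close>)
  qed
  have "(\<lambda>j. \<psi> (s (r j))) \<longlonglongrightarrow> \<psi> e" for \<psi> :: "'e \<Rightarrow>\<^sub>L real"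
  proof (rule ccontr)
    assume "\<not> ?thesis"
    then obtain \<epsilon> where \<epsilon>: "0 < \<epsilon>" "\<exists>\<^sub>F j in sequentially. \<epsilon> \<le> dist (\<psi> (s (r j))) (\<psi> e)"
      unfolding tendsto_iff by (auto simp: not_eventually not_less)
    obtain q where q: "strict_mono q" "\<And>j::nat. \<epsilon> \<le> dist (\<psi> (s (r (q j)))) (\<psi> e)"
      by (rule frequently_subsequence[OF \<epsilon>(2)]) blast
    from compactin_cluster_point[OF K, of "\<lambda>n. s (r (q n))"] s
    obtain e' where e': "\<And>U. openin weak_topology U \<Longrightarrow> e' \<in> U \<Longrightarrow> \<exists>\<^sub>F n in sequentially. s (r (q n)) \<in> U"
      by auto
    have "\<phi> i e' = \<phi> i e" for i
    proof (rule ccontr)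
      assume "\<phi> i e' \<noteq> \<phi> i e"
      then obtain U V where UV: "open U" "open V" "\<phi> i e' \<in> U" "\<phi> i e \<in> V" "U \<inter> V = {}"
        using hausdorff by metis
      have "\<forall>\<^sub>F n in sequentially. \<phi> i (s (r (q n))) \<in> V"
        using topological_tendstoD[OF LIMSEQ_subseq_LIMSEQ[OF lim q(1)] UV(2,4)] by (simp add: o_def)
      with e'[OF openin_weak_topology_vimage[OF UV(1), of "\<phi> i"]] UV
      have "\<exists>\<^sub>F n in sequentially. \<phi> i (s (r (q n))) \<in> U \<and> \<phi> i (s (r (q n))) \<in> V"
        by (intro frequently_eventually_frequently) auto
      then show False using UV(5) by (auto dest: frequently_ex)
    qed
    then have "e' = e" by (rule sep)
    then have "\<exists>\<^sub>F n in sequentially. s (r (q n)) \<in> \<psi> -` ball (\<psi> e) \<epsilon>"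
      using \<epsilon>(1) by (intro e' openin_weak_topology_vimage) auto
    then obtain n where "dist (\<psi> (s (r (q n)))) (\<psi> e) < \<epsilon>" 
      by (auto dest!: frequently_ex simp: dist_commute)
    then show False using q(2)[of n] by simp
  qed
  then have "limitin weak_topology (s \<circ> r) e sequentially" by (simp add: limitin_weak_topology)
  with r(1) show ?thesis by (rule that)
qed

text \<open>The link between the sequential lower limit \<open>f\<close> and the individual integrands. If the bound failed
for infinitely many indices at points of \<open>K\<close>, a subsequence of these points would converge weakly to
some \<open>e\<close>; padded with the constant \<open>e\<close> it becomes a sequence that competes in the infimum defining
\<open>f \<omega> e\<close>, and the Fenchel inequality for \<open>\<phi>\<close> at \<open>e\<close> would be violated. The bound is uniform on \<open>K\<close>,
which allows points of \<open>K\<close> that do not converge at all.\<close>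

lemma eventually_above_affine_on_weakly_compact:
  fixes f :: "nat \<Rightarrow> 'w \<Rightarrow> 'e::{real_normed_vector, second_countable_topology} \<Rightarrow> ereal"
  assumes K: "compactin weak_topology K"
    and less: "conjugate (seq_weak_li f) \<omega> \<phi> < ereal r"
  shows "\<forall>\<^sub>F n in sequentially. \<forall>e\<in>K. ereal (blinfun_apply \<phi> e - r) \<le> f n \<omega> e"
proof (rule ccontr)
  assume "\<not> ?thesis"
  then have "\<exists>\<^sub>F n in sequentially. \<exists>e\<in>K. f n \<omega> e < ereal (\<phi> e - r)"
    by (auto simp: not_eventually not_le)
  then obtain m where m: "strict_mono m" "\<And>j::nat. \<exists>e\<in>K. f (m j) \<omega> e < ereal (\<phi> e - r)"
    by (rule frequently_subsequence) metis
  then obtain s where s: "\<And>j. s j \<in> K" "\<And>j. f (m j) \<omega> (s j) < ereal (\<phi> (s j) - r)" by metis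
  obtain e q where q: "strict_mono q" "limitin weak_topology (s \<circ> q) e sequentially"
    using weakly_compact_imp_seq_compact[of K s] K s(1) by metis
  define k where "k = m \<circ> q"
  have k: "strict_mono k" unfolding k_def using m(1) q(1) by (rule strict_mono_o)
  then have inj: "inj k" by (rule strict_mono_imp_inj_on)
  define a where "a n = (if n \<in> range k then s (q (inv k n)) else e)" for n
  have ak: "a (k j) = s (q j)" for j by (simp add: a_def inv_f_f[OF inj])
  have "(\<lambda>n. \<psi> (a n)) \<longlonglongrightarrow> \<psi> e" for \<psi> :: "'e \<Rightarrow>\<^sub>L real"
  proof (rule topological_tendstoI)
    fix U assume U: "open U" "\<psi> e \<in> U"
    have "(\<lambda>j. \<psi> (s (q j))) \<longlonglongrightarrow> \<psi> e" using q(2) by (simp add: limitin_weak_topology)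
    from topological_tendstoD[OF this U] obtain J where J: "\<And>j. j \<ge> J \<Longrightarrow> \<psi> (s (q j)) \<in> U"
      by (auto simp: eventually_sequentially)
    have "\<psi> (a n) \<in> U" if "n \<ge> k J" for n
    proof (cases "n \<in> range k")
      case True
      then obtain j where j: "n = k j" by blast
      with that have "J \<le> j" using strict_mono_less_eq[OF k] by simp
      then show ?thesis using J by (simp add: j ak)
    next
      case False
      then show ?thesis using U by (simp add: a_def)
    qed
    then show "\<forall>\<^sub>F n in sequentially. \<psi> (a n) \<in> U" by (auto simp: eventually_sequentially)
  qed
  then have lim: "limitin weak_topology a e sequentially" by (simp add: limitin_weak_topology)
  then have "seq_weak_li f \<omega> e \<le> liminf (\<lambda>n. f n \<omega> (a n))"
    unfolding seq_weak_li_def by (intro Inf_lower) blast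
  also have "\<dots> \<le> liminf (\<lambda>j. f (k j) \<omega> (a (k j)))"
    using liminf_subseq_mono[OF k, of "\<lambda>n. f n \<omega> (a n)"] by (simp add: o_def)
  also have "\<dots> \<le> liminf (\<lambda>j. ereal (\<phi> (s (q j)) - r))"
  proof (intro Liminf_mono always_eventually allI)
    show "f (k j) \<omega> (a (k j)) \<le> ereal (\<phi> (s (q j)) - r)" for j
      unfolding ak using s(2)[of "q j"] by (simp add: k_def)
  qed
  also have "\<dots> = ereal (\<phi> e - r)"
    using q(2)
    by (intro lim_imp_Liminf) (auto simp: limitin_weak_topology o_def intro!: tendsto_diff)
  finally have "ereal r \<le> ereal (\<phi> e) - seq_weak_li f \<omega> e"
    by (cases "seq_weak_li f \<omega> e") auto
  also have "\<dots> \<le> conjugate (seq_weak_li f) \<omega> \<phi>"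
    unfolding conjugate_def by (rule SUP_upper) simp
  finally show False using less by simp
qed

section \<open>Convex combinations of biting convergent sequences\<close>

text \<open>With all functions as a real vector space, the integrable ones form a subspace on which the
\<open>L\<^sub>1\<close> norm is a seminorm, so that the separation lemma produces elements of \<^const>\<open>L1_dual\<close> directly.\<close>

instantiation "fun" :: (type, real_vector) real_vector
begin

definition "scaleR_fun c u = (\<lambda>x. c *\<^sub>R u x)"

instance
  by standard (simp_all add: scaleR_fun_def fun_eq_iff algebra_simps)

end

lemma sum_fun_apply: "(\<Sum>i\<in>A. g i) \<omega> = (\<Sum>i\<in>A. g i \<omega>)"
  by (induction A rule: infinite_finite_induct) auto

text \<open>Mazur's lemma. If all convex combinations of the tail kept \<open>L\<^sub>1\<close> distance \<open>\<epsilon>\<close> from \<open>x\<close>, a functional of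
norm at most 1 would be at least \<open>\<epsilon>\<close> on all differences \<open>xs i - x\<close> with \<open>i \<ge> m\<close>, against weak
convergence. Combinations are indexed by a block \<open>{1..k}\<close> together with a map \<open>j\<close> into the
tail, so that the same weights can be applied to other sequences.\<close>

lemma mazur_L1:
  fixes x :: "'w \<Rightarrow> 'e::{banach, second_countable_topology}"
  assumes xs: "\<And>n. integrable N (xs n)" and x: "integrable N x"
    and lim: "\<And>\<Lambda>. \<Lambda> \<in> L1_dual N \<Longrightarrow> (\<lambda>n. \<Lambda> (xs n)) \<longlonglongrightarrow> \<Lambda> x"
    and \<epsilon>: "0 < \<epsilon>"
  obtains k :: nat and u :: "nat \<Rightarrow> real" and j :: "nat \<Rightarrow> nat"
  where "\<And>i. i \<in> {1..k} \<Longrightarrow> 0 \<le> u i \<and> m \<le> j i" "sum u {1..k} = 1"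
    "(\<integral>\<omega>. norm ((\<Sum>i=1..k. u i *\<^sub>R xs (j i) \<omega>) - x \<omega>) \<partial>N) < \<epsilon>"
proof -
  let ?V = "{v :: 'w \<Rightarrow> 'e. integrable N v}"
  let ?N = "\<lambda>v :: 'w \<Rightarrow> 'e. \<integral>\<omega>. norm (v \<omega>) \<partial>N"
  let ?C = "convex hull ((\<lambda>i. xs i - x) ` {m..})"
  have V: "subspace ?V"
    by (auto simp: subspace_def scaleR_fun_def plus_fun_def zero_fun_def)
  have diff: "xs i - x \<in> ?V" for i
    using xs x by (simp add: fun_diff_def)
  have CV: "?C \<subseteq> ?V"
    by (rule hull_minimal) (use diff V in \<open>auto intro: subspace_imp_convex\<close>)
  have "\<exists>c\<in>?C. ?N c < \<epsilon>"
  proof (rule ccontr)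
    assume "\<not> ?thesis"
    then have far: "\<epsilon> \<le> ?N c" if "c \<in> ?C" for c using that by (auto simp: not_less)
    obtain l where l: "linear l" "\<And>v. v \<in> ?V \<Longrightarrow> \<bar>l v\<bar> \<le> ?N v" "\<And>c. c \<in> ?C \<Longrightarrow> \<epsilon> \<le> l c"
    proof (rule seminorm_separation[of ?V ?N ?C \<epsilon>])
      show "?N (v + v') \<le> ?N v + ?N v'" if "v \<in> ?V" "v' \<in> ?V" for v v'
      proof -
        have "?N (v + v') \<le> (\<integral>\<omega>. norm (v \<omega>) + norm (v' \<omega>) \<partial>N)"
          using that by (intro integral_mono) (auto intro: norm_triangle_ineq)
        also have "\<dots> = ?N v + ?N v'" using that by simp
        finally show ?thesis .
      qed
      show "?N (c *\<^sub>R v) = \<bar>c\<bar> * ?N v" for c v by (simp add: scaleR_fun_def)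
    qed (use V CV far in \<open>auto simp: hull_inc\<close>)
    have "l \<in> L1_dual N"
      unfolding L1_dual_def using l(2) linear_add[OF l(1)] linear_scale[OF l(1)]
      by (auto simp: plus_fun_def scaleR_fun_def intro!: exI[of _ 1])
    then have "(\<lambda>n. l (xs n) - l x) \<longlonglongrightarrow> 0" using lim LIM_zero by blast
    moreover have "\<epsilon> \<le> l (xs n) - l x" if "m \<le> n" for n
    proof -
      have "xs n - x \<in> ?C" using that by (intro hull_inc) auto
      then show ?thesis using l(3) linear_diff[OF l(1)] by metis
    qed
    ultimately have "\<epsilon> \<le> 0" by (intro LIMSEQ_le_const) auto
    then show False using \<epsilon> by simp
  qed
  then obtain c where c: "c \<in> ?C" "?N c < \<epsilon>" by blast
  from c(1) obtain k :: nat and u y where u: "\<forall>i\<in>{1..k}. 0 \<le> u i \<and> y i \<in> (\<lambda>i. xs i - x) ` {m..}"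
    "sum u {1..k} = 1" "(\<Sum>i=1..k. u i *\<^sub>R y i) = c"
    unfolding convex_hull_indexed by blast
  have "\<forall>i. \<exists>j. i \<in> {1..k} \<longrightarrow> m \<le> j \<and> y i = xs j - x" using u(1) by fastforce
  then obtain j where j: "\<And>i. i \<in> {1..k} \<Longrightarrow> m \<le> j i \<and> y i = xs (j i) - x" by metis
  have "c \<omega> = (\<Sum>i=1..k. u i *\<^sub>R xs (j i) \<omega>) - x \<omega>" for \<omega>
  proof -
    have "c \<omega> = (\<Sum>i=1..k. u i *\<^sub>R (xs (j i) \<omega> - x \<omega>))"
      using j by (simp add: u(3)[symmetric] sum_fun_apply scaleR_fun_def fun_diff_def)
    also have "\<dots> = (\<Sum>i=1..k. u i *\<^sub>R xs (j i) \<omega>) - (\<Sum>i=1..k. u i) *\<^sub>R x \<omega>"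
      by (simp add: scaleR_diff_right sum_subtractf scaleR_left.sum)
    finally show ?thesis using u(2) by simp
  qed
  then show ?thesis using that[of k u j] u j c(2) by auto
qed

text \<open>Used both to pass from \<open>L\<^sub>1\<close> to almost everywhere convergence and, with multiples of indicators, as
a Borel--Cantelli lemma on spaces of infinite measure.\<close>

lemma AE_summable_of_summable_integrals:
  fixes g :: "nat \<Rightarrow> 'w \<Rightarrow> real"
  assumes g: "\<And>n. integrable M (g n)" "\<And>n \<omega>. 0 \<le> g n \<omega>" and sum: "summable (\<lambda>n. \<integral>\<omega>. g n \<omega> \<partial>M)"
  shows "AE \<omega> in M. summable (\<lambda>n. g n \<omega>)"
proof -
  have [measurable]: "g n \<in> borel_measurable M" for n using g(1) by simp
  have "(\<integral>\<^sup>+\<omega>. (\<Sum>n. ennreal (g n \<omega>)) \<partial>M) = (\<Sum>n. ennreal (\<integral>\<omega>. g n \<omega> \<partial>M))"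
    using g by (subst nn_integral_suminf) (auto simp: nn_integral_eq_integral)
  also have "\<dots> \<noteq> \<infinity>"
    using sum g(2) by (subst suminf_ennreal2) auto
  finally have "AE \<omega> in M. (\<Sum>n. ennreal (g n \<omega>)) \<noteq> \<infinity>"
    by (intro nn_integral_PInf_AE) auto
  then show ?thesis
    by eventually_elim (use g(2) in \<open>auto intro: summable_suminf_not_top\<close>)
qed

lemma L1_dual_nonempty: "L1_dual N \<noteq> {}"
proof -
  have "(\<lambda>_. 0) \<in> L1_dual N" by (auto simp: L1_dual_def intro: exI[of _ 0])
  then show ?thesis by blast
qed

lemma biting_converges_subseq:
  assumes "biting_converges M xs x" "strict_mono r"
  shows "biting_converges M (xs \<circ> r) x"
proof -
  have "weakly_converges_L1 N (xs \<circ> r) x" if "weakly_converges_L1 N xs x" for N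
    using that LIMSEQ_subseq_LIMSEQ[OF _ assms(2)] 
    unfolding weakly_converges_L1_def weak_L1_topology_def limitin_initial_topology[OF L1_dual_nonempty]
    by (fastforce simp: o_def)
  then show ?thesis using assms(1) unfolding biting_converges_def by blast
qed

text \<open>Mazur's lemma is applied on the \<open>m\<close>-th set of the covering with error \<open>(1/2)^m\<close>. On every fixed set the
errors are then summable, so one sequence of weights works almost everywhere on the whole space.\<close>

lemma biting_converges_convex_combinations:
  fixes x :: "'w \<Rightarrow> 'e::{banach, second_countable_topology}"
  assumes "biting_converges M xs x"
  obtains k :: "nat \<Rightarrow> nat" and u :: "nat \<Rightarrow> nat \<Rightarrow> real" and j :: "nat \<Rightarrow> nat \<Rightarrow> nat"
  where "\<And>m i. i \<in> {1..k m} \<Longrightarrow> 0 \<le> u m i \<and> m \<le> j m i" "\<And>m. sum (u m) {1..k m} = 1"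
    "AE \<omega> in M. (\<lambda>m. \<Sum>i=1..k m. u m i *\<^sub>R xs (j m i) \<omega>) \<longlonglongrightarrow> x \<omega>"
proof -
  obtain \<Omega> where \<Omega>: "\<And>k. \<Omega> k \<in> sets M" "incseq \<Omega>" "space M - (\<Union>k. \<Omega> k) \<in> null_sets M"
    and w: "\<And>k::nat. weakly_converges_L1 (restrict_space M (\<Omega> k)) xs x"
    using assms unfolding biting_converges_def by blast
  let ?N = "\<lambda>m. restrict_space M (\<Omega> m)"
  have int: "integrable (?N m) (xs n)" "integrable (?N m) x"
    and lim: "\<And>\<Lambda>. \<Lambda> \<in> L1_dual (?N m) \<Longrightarrow> (\<lambda>n. \<Lambda> (xs n)) \<longlonglongrightarrow> \<Lambda> x" for m n
    using w[of m] unfolding weakly_converges_L1_def weak_L1_topology_def limitin_initial_topology[OF L1_dual_nonempty]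
    by auto
  define P where "P m k u j \<longleftrightarrow> (\<forall>i\<in>{1..k}. 0 \<le> u i \<and> m \<le> j i) \<and> sum u {1..k} = 1 \<and>
      (\<integral>\<omega>. norm ((\<Sum>i=1..k. u i *\<^sub>R xs (j i) \<omega>) - x \<omega>) \<partial>(?N m)) < (1/2)^m"
    for m k :: nat and u :: "nat \<Rightarrow> real" and j
  have "\<exists>k u j. P m k u j" for m
  proof (rule mazur_L1[where N = "?N m" and xs = xs and x = x and \<epsilon> = "(1/2)^m" and m = m])
    fix k :: nat and u :: "nat \<Rightarrow> real" and j
    assume "\<And>i. i \<in> {1..k} \<Longrightarrow> 0 \<le> u i \<and> m \<le> j i" "sum u {1..k} = 1"
      "(\<integral>\<omega>. norm ((\<Sum>i=1..k. u i *\<^sub>R xs (j i) \<omega>) - x \<omega>) \<partial>(?N m)) < (1/2)^m"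
    then have "P m k u j" unfolding P_def by auto
    then show "\<exists>k u j. P m k u j" by (intro exI)
  qed (simp_all add: int lim)
  then obtain k u j where P: "\<And>m. P m (k m) (u m) (j m)" by metis
  have kuj: "\<And>m. (\<forall>i\<in>{1..k m}. 0 \<le> u m i \<and> m \<le> j m i)"
      "\<And>m. sum (u m) {1..k m} = (1::real)"
      "\<And>m. (\<integral>\<omega>. norm ((\<Sum>i=1..k m. u m i *\<^sub>R xs (j m i) \<omega>) - x \<omega>) \<partial>(?N m)) < (1/2)^m"
    using P unfolding P_def by auto
  define D where "D m \<omega> = norm ((\<Sum>i=1..k m. u m i *\<^sub>R xs (j m i) \<omega>) - x \<omega>)" for m \<omega>
  define g where "g m \<omega> = indicator (\<Omega> m) \<omega> *\<^sub>R D m \<omega>" for m \<omega>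
  have \<Omega>': "\<Omega> m \<inter> space M \<in> sets M" for m using \<Omega>(1) by auto
  have "integrable (?N m) (D m)" for m
    unfolding D_def by (intro integrable_norm Bochner_Integration.integrable_diff
        Bochner_Integration.integrable_sum integrable_scaleR_right int)
  then have gi: "integrable M (g m)" for m
    unfolding g_def using integrable_restrict_space[OF \<Omega>'] by blast
  have "(\<integral>\<omega>. g m \<omega> \<partial>M) < (1/2)^m" for m
    using kuj(3)[of m] integral_restrict_space[OF \<Omega>', of m "D m"] by (simp add: g_def D_def[abs_def])
  moreover have "0 \<le> g m \<omega>" for m \<omega> by (simp add: g_def D_def)
  ultimately have "summable (\<lambda>m. \<integral>\<omega>. g m \<omega> \<partial>M)"
    by (intro summable_comparison_test'[OF summable_geometric[of "1/2::real"]])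
      (auto simp: less_imp_le)
  then have "AE \<omega> in M. summable (\<lambda>m. g m \<omega>)"
    using gi \<open>\<And>m \<omega>. 0 \<le> g m \<omega>\<close> by (rule AE_summable_of_summable_integrals[rotated 2])
  moreover have "AE \<omega> in M. \<omega> \<in> (\<Union>k. \<Omega> k)"
    using AE_not_in[OF \<Omega>(3)] AE_space by eventually_elim auto
  ultimately have "AE \<omega> in M. (\<lambda>m. \<Sum>i=1..k m. u m i *\<^sub>R xs (j m i) \<omega>) \<longlonglongrightarrow> x \<omega>"
  proof eventually_elim
    case (elim \<omega>)
    then obtain k0 where "\<omega> \<in> \<Omega> k0" by blast
    then have "\<forall>m\<ge>k0. \<omega> \<in> \<Omega> m" using \<Omega>(2) by (auto simp: incseq_def)
    then have "\<forall>\<^sub>F m in sequentially. g m \<omega> = D m \<omega>"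
      by (auto simp: g_def eventually_sequentially intro!: exI[of _ k0])
    with summable_LIMSEQ_zero[OF elim(1)] have "(\<lambda>m. D m \<omega>) \<longlonglongrightarrow> 0" by (rule Lim_transform_eventually)
    then show ?case unfolding D_def by (simp add: tendsto_norm_zero_iff LIM_zero_iff)
  qed
  with kuj show ?thesis by (intro that[of k u j]) auto
qed

section \<open>Removing concentrations of mass\<close>

text \<open>A form of Chacon's biting lemma. The weight \<open>w\<close> replaces the finiteness of the measure: tails are cut
at multiples of \<open>w\<close> instead of constants. Let \<open>\<alpha>\<close> be the amount of mass that escapes, that is, the
limit for \<open>q \<rightarrow> \<infinity>\<close> of the upper limit in \<open>n\<close> of the integral of \<open>u n\<close> over \<open>{u n > q w}\<close>. Along a
suitable subsequence the part of \<open>u (r l)\<close> above the rapidly growing level \<open>2 ^ l w\<close> already carries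
mass \<open>\<alpha>\<close> up to a vanishing error. The sets where this happens are so small that their tail
unions \<open>S l\<close> decrease to a null set, and no mass remains to escape outside of them.\<close>

lemma biting_truncation:
  fixes u :: "nat \<Rightarrow> 'w \<Rightarrow> real" and w :: "'w \<Rightarrow> real"
  assumes u: "\<And>n. integrable M (u n)" "\<And>n \<omega>. 0 \<le> u n \<omega>" "\<And>n. (\<integral>\<omega>. u n \<omega> \<partial>M) \<le> C"
    and w: "integrable M w" "\<And>\<omega>. \<omega> \<in> space M \<Longrightarrow> 0 < w \<omega>"
  obtains r :: "nat \<Rightarrow> nat" and S :: "nat \<Rightarrow> 'w set"
  where "strict_mono r" "\<And>l. S l \<in> sets M" "decseq S" "(\<Inter>l. S l) \<in> null_sets M"
    "\<And>\<epsilon>. 0 < \<epsilon> \<Longrightarrow> \<exists>q::nat. \<forall>\<^sub>F l in sequentially.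
       (\<integral>\<omega>. indicator {\<omega> \<in> space M - S l. real q * w \<omega> < u (r l) \<omega>} \<omega> * u (r l) \<omega> \<partial>M) \<le> \<epsilon>"
proof -
  have [measurable]: "u n \<in> borel_measurable M" "w \<in> borel_measurable M" for n
    using u(1) w(1) by auto
  define A where "A n q = {\<omega> \<in> space M. real q * w \<omega> < u n \<omega>}" for n q :: nat
  have A[measurable]: "A n q \<in> sets M" for n q unfolding A_def by measurable
  define T where "T n q = (\<integral>\<omega>. indicator (A n q) \<omega> * u n \<omega> \<partial>M)" for n q
  have int: "integrable M (\<lambda>\<omega>. indicator B \<omega> * u n \<omega>)" if "B \<in> sets M" for B n
    using integrable_real_mult_indicator[OF that u(1)] by (simp add: mult.commute)
  have T: "0 \<le> T n q" "T n q \<le> C" for n q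
  proof -
    show "0 \<le> T n q" unfolding T_def using u(2) by (intro integral_nonneg_AE) auto
    have "T n q \<le> (\<integral>\<omega>. u n \<omega> \<partial>M)"
      unfolding T_def using u(2) by (intro integral_mono int u A) (auto simp: indicator_def)
    then show "T n q \<le> C" using u(3) by (rule order_trans)
  qed
  \<comment> \<open>The supremum of \<open>X\<close> is the escaping mass \<open>\<alpha>\<close>.\<close>
  define X where "X = {a. \<forall>q. \<exists>\<^sub>F n in sequentially. a \<le> T n q}"
  have X0: "0 \<in> X" using T(1) by (simp add: X_def)
  have XC: "a \<le> C" if "a \<in> X" for a
  proof -
    from that have "\<exists>\<^sub>F n in sequentially. a \<le> T n 0" by (simp add: X_def)
    then obtain n where "a \<le> T n 0" by (auto dest: frequently_ex)
    then show ?thesis using T(2) by (rule order_trans)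
  qed
  have bdd: "bdd_above X" by (rule bdd_aboveI[of X C]) (rule XC)
  define \<alpha> where "\<alpha> = Sup X"
  have freq: "\<exists>\<^sub>F n in sequentially. \<alpha> - inverse (real (Suc l)) \<le> T n (2 ^ l)" for l
  proof -
    have "\<alpha> - inverse (real (Suc l)) < \<alpha>" by simp
    then obtain a where a: "a \<in> X" "\<alpha> - inverse (real (Suc l)) < a"
      unfolding \<alpha>_def using X0 less_cSup_iff[OF _ bdd] by blast
    then have "\<exists>\<^sub>F n in sequentially. a \<le> T n (2 ^ l)" by (simp add: X_def)
    then show ?thesis by (rule frequently_elim1) (use a(2) in simp)
  qed
  obtain r where r: "strict_mono r" "\<And>l. \<alpha> - inverse (real (Suc l)) \<le> T (r l) (2 ^ l)"
    by (rule frequently_subsequence[of "\<lambda>l n. \<alpha> - inverse (real (Suc l)) \<le> T n (2 ^ l)", OF freq]) simp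
  define S where "S l = (\<Union>m\<in>{l..}. A (r m) (2 ^ m))" for l
  have S[measurable]: "S l \<in> sets M" for l unfolding S_def by measurable
  have "decseq S" unfolding S_def decseq_def by force
  have "AE \<omega> in M. \<omega> \<notin> (\<Inter>l. S l)"
  proof -
    define g where "g m \<omega> = indicator (A (r m) (2 ^ m)) \<omega> * w \<omega>" for m \<omega>
    have g0: "0 \<le> g m \<omega>" for m \<omega>
      using w(2) by (auto simp: g_def A_def indicator_def intro: less_imp_le)
    have gi: "integrable M (g m)" for m
      using integrable_real_mult_indicator[OF A w(1)] by (simp add: g_def[abs_def] mult.commute)
    have "(\<integral>\<omega>. g m \<omega> \<partial>M) \<le> C * (1/2)^m" for m
    proof -
      have "(\<integral>\<omega>. g m \<omega> \<partial>M) \<le> (\<integral>\<omega>. (1/2)^m * u (r m) \<omega> \<partial>M)"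
      proof (intro integral_mono gi integrable_mult_right u(1))
        show "g m \<omega> \<le> (1/2)^m * u (r m) \<omega>" for \<omega>
          using u(2)[of "r m" \<omega>] by (auto simp: g_def A_def indicator_def field_simps)
      qed
      also have "\<dots> \<le> (1/2)^m * C" using u(3)[of "r m"] by simp
      finally show ?thesis by (simp add: mult.commute)
    qed
    then have "summable (\<lambda>m. \<integral>\<omega>. g m \<omega> \<partial>M)"
      using g0 by (intro summable_comparison_test'[OF summable_mult[OF summable_geometric[of "1/2::real"]], where c1 = C])
        auto
    then have "AE \<omega> in M. summable (\<lambda>m. g m \<omega>)"
      by (rule AE_summable_of_summable_integrals[OF gi g0])
    then show ?thesis
      using AE_space
    proof eventually_elim
      case (elim \<omega>)
      have "\<forall>\<^sub>F m in sequentially. g m \<omega> < w \<omega>"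
        using order_tendstoD(2)[OF summable_LIMSEQ_zero[OF elim(1)] w(2)[OF elim(2)]] .
      then obtain l where "\<And>m. l \<le> m \<Longrightarrow> g m \<omega> < w \<omega>" by (auto simp: eventually_sequentially)
      then have "\<omega> \<notin> S l" unfolding S_def g_def by (force simp: indicator_def)
      then show ?case by blast
    qed
  qed
  moreover have "(\<Inter>l. S l) \<in> sets M" by measurable
  ultimately have null: "(\<Inter>l. S l) \<in> null_sets M" by (simp add: AE_iff_null_sets)
  show ?thesis
  proof (rule that[OF r(1) S \<open>decseq S\<close> null])
    fix \<epsilon> :: real assume "0 < \<epsilon>"
    have "\<alpha> + \<epsilon> / 2 \<notin> X"
    proof
      assume "\<alpha> + \<epsilon> / 2 \<in> X"
      from cSup_upper[OF this bdd] \<open>0 < \<epsilon>\<close> show False by (simp add: \<alpha>_def)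
    qed
    then obtain q where q: "\<forall>\<^sub>F n in sequentially. T n q < \<alpha> + \<epsilon> / 2"
      by (auto simp: X_def not_frequently not_le)
    have "\<forall>\<^sub>F l in sequentially. inverse (real (Suc l)) < \<epsilon> / 2"
      using order_tendstoD(2)[OF LIMSEQ_inverse_real_of_nat, of "\<epsilon> / 2"] \<open>0 < \<epsilon>\<close> by simp
    moreover have "\<forall>\<^sub>F l in sequentially. T (r l) q < \<alpha> + \<epsilon> / 2"
      using eventually_subseq[OF r(1) q] .
    ultimately have "\<forall>\<^sub>F l in sequentially.
       (\<integral>\<omega>. indicator {\<omega> \<in> space M - S l. real q * w \<omega> < u (r l) \<omega>} \<omega> * u (r l) \<omega> \<partial>M) \<le> \<epsilon>"
      using eventually_ge_at_top[of q]
    proof eventually_elim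
      case (elim l)
      have ql: "real q \<le> 2 ^ l"
      proof -
        have "q \<le> 2 ^ l" using elim(3) less_exp[of l] by linarith
        then have "real q \<le> real (2 ^ l)" by (simp only: of_nat_le_iff)
        then show ?thesis by simp
      qed
      \<comment> \<open>Outside \<open>S l\<close> the level \<open>2 ^ l w\<close> is never exceeded, so only the values between the two levels count.\<close>
      have "(\<integral>\<omega>. indicator {\<omega> \<in> space M - S l. real q * w \<omega> < u (r l) \<omega>} \<omega> * u (r l) \<omega> \<partial>M)
          \<le> (\<integral>\<omega>. indicator (A (r l) q) \<omega> * u (r l) \<omega> - indicator (A (r l) (2 ^ l)) \<omega> * u (r l) \<omega> \<partial>M)"
      proof (intro integral_mono Bochner_Integration.integrable_diff int A)
        show "{\<omega> \<in> space M - S l. real q * w \<omega> < u (r l) \<omega>} \<in> sets M" by measurable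
        fix \<omega> assume \<omega>: "\<omega> \<in> space M"
        have "real q * w \<omega> \<le> 2 ^ l * w \<omega>" using ql w(2)[OF \<omega>] by (intro mult_right_mono) auto
        moreover have "\<omega> \<in> S l" if "2 ^ l * w \<omega> < u (r l) \<omega>"
          unfolding S_def using that \<omega> by (auto simp: A_def intro!: bexI[of _ l])
        ultimately show "indicator {\<omega> \<in> space M - S l. real q * w \<omega> < u (r l) \<omega>} \<omega> * u (r l) \<omega>
          \<le> indicator (A (r l) q) \<omega> * u (r l) \<omega> - indicator (A (r l) (2 ^ l)) \<omega> * u (r l) \<omega>"
          using u(2)[of "r l" \<omega>] \<omega> by (auto simp: A_def indicator_def)
      qed
      also have "\<dots> = T (r l) q - T (r l) (2 ^ l)"
        unfolding T_def by (intro Bochner_Integration.integral_diff int A)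
      also have "\<dots> \<le> \<epsilon>" using elim(1,2) r(2)[of l] by linarith
      finally show ?case .
    qed
    then show "\<exists>q::nat. \<forall>\<^sub>F l in sequentially.
       (\<integral>\<omega>. indicator {\<omega> \<in> space M - S l. real q * w \<omega> < u (r l) \<omega>} \<omega> * u (r l) \<omega> \<partial>M) \<le> \<epsilon>" ..
  qed
qed

section \<open>Upper integrals\<close>

text \<open>Fatou's lemma, after adding \<open>g\<close> to make everything nonnegative; convex combinations of late
members of the sequence inherit both the lower bound \<open>- g\<close> and the bound \<open>B\<close> on the integrals.\<close>

lemma upper_integral_le_of_convex_combinations:
  fixes Z :: "nat \<Rightarrow> 'w \<Rightarrow> real" and c :: "nat \<Rightarrow> nat \<Rightarrow> real"
  assumes Z: "\<And>i. integrable M (Z i)" "\<And>i \<omega>. \<omega> \<in> space M \<Longrightarrow> - g \<omega> \<le> Z i \<omega>" and g: "integrable M g"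
    and B: "\<forall>\<^sub>F i in sequentially. (\<integral>\<omega>. Z i \<omega> \<partial>M) \<le> B"
    and c: "\<And>m i. i \<in> {1..k m} \<Longrightarrow> 0 \<le> c m i \<and> m \<le> j m i" "\<And>m. sum (c m) {1..k m} = 1"
    and F: "AE \<omega> in M. F \<omega> \<le> liminf (\<lambda>m. ereal (\<Sum>i=1..k m. c m i * Z (j m i) \<omega>))"
  shows "upper_integral M F \<le> ereal B"
proof -
  define W where "W m \<omega> = (\<Sum>i=1..k m. c m i * Z (j m i) \<omega>)" for m \<omega>
  have Wi: "integrable M (W m)" for m
    unfolding W_def by (intro Bochner_Integration.integrable_sum integrable_mult_right Z)
  have [measurable]: "W m \<in> borel_measurable M" "g \<in> borel_measurable M" for m using Wi g by auto
  have W0: "0 \<le> W m \<omega> + g \<omega>" if "\<omega> \<in> space M" for m \<omega>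
  proof -
    have "(\<Sum>i=1..k m. c m i * (- g \<omega>)) \<le> W m \<omega>"
      unfolding W_def using c(1) Z(2)[OF that] by (intro sum_mono mult_left_mono) auto
    then show ?thesis by (simp add: sum_distrib_right[symmetric] sum_negf c(2)[simplified])
  qed
  have WB: "\<forall>\<^sub>F m in sequentially. (\<integral>\<omega>. W m \<omega> \<partial>M) \<le> B"
  proof -
    obtain i0 where i0: "\<And>i. i0 \<le> i \<Longrightarrow> (\<integral>\<omega>. Z i \<omega> \<partial>M) \<le> B"
      using B by (auto simp: eventually_sequentially)
    have "(\<integral>\<omega>. W m \<omega> \<partial>M) \<le> B" if "i0 \<le> m" for m
    proof -
      have "(\<integral>\<omega>. W m \<omega> \<partial>M) = (\<Sum>i=1..k m. c m i * (\<integral>\<omega>. Z (j m i) \<omega> \<partial>M))"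
        unfolding W_def using Z(1) by (subst Bochner_Integration.integral_sum) auto
      also have "\<dots> \<le> (\<Sum>i=1..k m. c m i * B)"
        using c(1) that by (intro sum_mono mult_left_mono i0) (auto intro: order_trans)
      also have "\<dots> = B" by (simp add: sum_distrib_right[symmetric] c(2)[simplified])
      finally show ?thesis .
    qed
    then show ?thesis by (auto simp: eventually_sequentially)
  qed
  define R where "R \<omega> = liminf (\<lambda>m. ennreal (W m \<omega> + g \<omega>))" for \<omega>
  have [measurable]: "R \<in> borel_measurable M" unfolding R_def by measurable
  let ?b = "B + (\<integral>\<omega>. g \<omega> \<partial>M)"
  have nn: "(\<integral>\<^sup>+\<omega>. ennreal (W m \<omega> + g \<omega>) \<partial>M) = ennreal ((\<integral>\<omega>. W m \<omega> \<partial>M) + (\<integral>\<omega>. g \<omega> \<partial>M))" for m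
    using Wi g W0 by (subst nn_integral_eq_integral) (auto intro!: AE_I2)
  have "(\<integral>\<^sup>+\<omega>. R \<omega> \<partial>M) \<le> liminf (\<lambda>m. \<integral>\<^sup>+\<omega>. ennreal (W m \<omega> + g \<omega>) \<partial>M)"
    unfolding R_def by (rule nn_integral_liminf) measurable
  also have "\<dots> \<le> limsup (\<lambda>m. \<integral>\<^sup>+\<omega>. ennreal (W m \<omega> + g \<omega>) \<partial>M)"
    by (rule Liminf_le_Limsup) simp
  also have "\<dots> \<le> ennreal ?b"
    unfolding nn by (rule Limsup_bounded) (use WB in \<open>eventually_elim, auto intro!: ennreal_leI\<close>)
  finally have Rb: "(\<integral>\<^sup>+\<omega>. R \<omega> \<partial>M) \<le> ennreal ?b" .
  have b0: "0 \<le> ?b"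
  proof -
    obtain m where m: "(\<integral>\<omega>. W m \<omega> \<partial>M) \<le> B" using WB by (auto simp: eventually_sequentially)
    have "0 \<le> (\<integral>\<omega>. W m \<omega> + g \<omega> \<partial>M)" using W0 by (intro integral_nonneg_AE AE_I2) auto
    then show ?thesis using m Wi g by simp
  qed
  have Rfin: "AE \<omega> in M. R \<omega> \<noteq> \<infinity>"
    using Rb by (intro nn_integral_PInf_AE) (auto simp: top_unique)
  have eqR: "(\<integral>\<^sup>+\<omega>. ennreal (enn2real (R \<omega>)) \<partial>M) = (\<integral>\<^sup>+\<omega>. R \<omega> \<partial>M)"
    by (rule nn_integral_cong_AE) (use Rfin in \<open>eventually_elim, auto simp: less_top\<close>)
  have Ri: "integrable M (\<lambda>\<omega>. enn2real (R \<omega>))"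
    by (rule integrableI_nonneg) (use eqR Rb in \<open>auto simp: less_top[symmetric] top_unique\<close>)
  have "ennreal (\<integral>\<omega>. enn2real (R \<omega>) \<partial>M) \<le> ennreal ?b"
    using Rb Ri by (subst nn_integral_eq_integral[symmetric]) (auto simp: eqR)
  then have le: "(\<integral>\<omega>. enn2real (R \<omega>) \<partial>M) \<le> ?b" using b0 by simp
  have "AE \<omega> in M. F \<omega> \<le> ereal (enn2real (R \<omega>) - g \<omega>)"
    using F Rfin AE_space
  proof eventually_elim
    case (elim \<omega>)
    show ?case
    proof (rule ccontr)
      assume "\<not> ?thesis"
      then have "ereal (enn2real (R \<omega>) - g \<omega>) < liminf (\<lambda>m. ereal (W m \<omega>))"
        using elim(1) unfolding W_def by (auto simp: not_le intro: less_le_trans)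
      from ereal_dense2[OF this] obtain s
        where s: "enn2real (R \<omega>) - g \<omega> < s" "ereal s < liminf (\<lambda>m. ereal (W m \<omega>))"
        by auto
      have "\<forall>\<^sub>F m in sequentially. ereal s < ereal (W m \<omega>)" by (rule less_LiminfD[OF s(2)])
      then have "\<forall>\<^sub>F m in sequentially. ennreal (s + g \<omega>) \<le> ennreal (W m \<omega> + g \<omega>)"
        by eventually_elim (auto intro!: ennreal_leI)
      then have "ennreal (s + g \<omega>) \<le> R \<omega>" unfolding R_def by (rule Liminf_bounded)
      moreover have "R \<omega> = ennreal (enn2real (R \<omega>))" using elim(2) by (simp add: less_top)
      ultimately have "ennreal (s + g \<omega>) \<le> ennreal (enn2real (R \<omega>))" by simp
      then have "s + g \<omega> \<le> enn2real (R \<omega>)" by (simp add: ennreal_le_iff)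
      then show False using s(1) by simp
    qed
  qed
  then have "upper_integral M F \<le> ereal (\<integral>\<omega>. enn2real (R \<omega>) - g \<omega> \<partial>M)"
    unfolding upper_integral_def using Ri g
    by (intro Inf_lower CollectI exI[of _ "\<lambda>\<omega>. enn2real (R \<omega>) - g \<omega>"]) auto
  also have "\<dots> \<le> ereal B" using le Ri g by simp
  finally show ?thesis .
qed

lemma integrable_enn2real:
  assumes "N \<in> borel_measurable M" "(\<integral>\<^sup>+\<omega>. N \<omega> \<partial>M) \<le> ennreal C" "0 \<le> C"
  shows "integrable M (\<lambda>\<omega>. enn2real (N \<omega>))" "(\<integral>\<omega>. enn2real (N \<omega>) \<partial>M) \<le> C"
    "AE \<omega> in M. N \<omega> = ennreal (enn2real (N \<omega>))"
proof -
  have "AE \<omega> in M. N \<omega> \<noteq> \<infinity>"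
    using assms by (intro nn_integral_PInf_AE) (auto simp: top_unique)
  then show ae: "AE \<omega> in M. N \<omega> = ennreal (enn2real (N \<omega>))"
    by eventually_elim (simp add: less_top)
  have eq: "(\<integral>\<^sup>+\<omega>. ennreal (enn2real (N \<omega>)) \<partial>M) = (\<integral>\<^sup>+\<omega>. N \<omega> \<partial>M)"
    by (rule nn_integral_cong_AE) (use ae in \<open>eventually_elim, simp\<close>)
  show int: "integrable M (\<lambda>\<omega>. enn2real (N \<omega>))"
    by (rule integrableI_nonneg) (use eq assms in \<open>auto simp: less_top[symmetric] top_unique\<close>)
  have "ennreal (\<integral>\<omega>. enn2real (N \<omega>) \<partial>M) \<le> ennreal C"
    using int assms(2) by (subst nn_integral_eq_integral[symmetric]) (auto simp: eq)
  then show "(\<integral>\<omega>. enn2real (N \<omega>) \<partial>M) \<le> C" using assms(3) by simp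
qed

lemma measurable_integrand_compose:
  assumes "measurable_integrand M f" and [measurable]: "x \<in> borel_measurable M"
  shows "(\<lambda>\<omega>. f \<omega> (x \<omega>)) \<in> borel_measurable M"
proof -
  have "(\<lambda>(\<omega>, e). f \<omega> e) \<circ> (\<lambda>\<omega>. (\<omega>, x \<omega>)) \<in> borel_measurable M"
    using assms(1) unfolding measurable_integrand_def by (rule measurable_comp[rotated]) measurable
  then show ?thesis by (simp add: o_def)
qed

lemma integral_le_upper_integral:
  assumes "integrable M V" "AE \<omega> in M. ereal (V \<omega>) \<le> v \<omega>"
  shows "ereal (\<integral>\<omega>. V \<omega> \<partial>M) \<le> upper_integral M v"
  unfolding upper_integral_def
proof (rule Inf_greatest, clarify)
  fix u assume u: "integrable M u" "AE \<omega> in M. v \<omega> \<le> ereal (u \<omega>)"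
  have "AE \<omega> in M. V \<omega> \<le> u \<omega>"
    using assms(2) u(2) by eventually_elim (metis ereal_less_eq(3) order_trans)
  then show "ereal (\<integral>\<omega>. V \<omega> \<partial>M) \<le> ereal (\<integral>\<omega>. u \<omega> \<partial>M)"
    using assms(1) u(1) by (simp add: integral_mono_AE)
qed

lemma upper_integral_le_integral:
  assumes "integrable M V" "AE \<omega> in M. v \<omega> \<le> ereal (V \<omega>)"
  shows "upper_integral M v \<le> ereal (\<integral>\<omega>. V \<omega> \<partial>M)"
  unfolding upper_integral_def using assms by (intro Inf_lower) auto

lemma integrable_representative:
  assumes v[measurable]: "v \<in> borel_measurable M"
    and N: "integrable M N" "AE \<omega> in M. - v \<omega> \<le> ereal (N \<omega>)"
    and fin: "upper_integral M v < \<infinity>"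
  obtains V where "integrable M V" "AE \<omega> in M. v \<omega> = ereal (V \<omega>)"
    "upper_integral M v = ereal (\<integral>\<omega>. V \<omega> \<partial>M)"
proof -
  obtain u where u: "integrable M u" "AE \<omega> in M. v \<omega> \<le> ereal (u \<omega>)"
    using fin unfolding upper_integral_def Inf_less_iff by blast
  define V where "V \<omega> = real_of_ereal (v \<omega>)" for \<omega>
  have ae: "AE \<omega> in M. v \<omega> = ereal (V \<omega>) \<and> norm (V \<omega>) \<le> norm (\<bar>u \<omega>\<bar> + \<bar>N \<omega>\<bar>)"
    using u(2) N(2)
  proof eventually_elim
    case (elim \<omega>)
    then show ?case by (cases "v \<omega>") (auto simp: V_def)
  qed
  have V: "integrable M V"
  proof (rule Bochner_Integration.integrable_bound)
    show "integrable M (\<lambda>\<omega>. \<bar>u \<omega>\<bar> + \<bar>N \<omega>\<bar>)" using u(1) N(1) by simp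
    show "V \<in> borel_measurable M" unfolding V_def by measurable
  qed (use ae in \<open>eventually_elim, simp\<close>)
  have eq: "AE \<omega> in M. v \<omega> = ereal (V \<omega>)" using ae by eventually_elim simp
  have "upper_integral M v = ereal (\<integral>\<omega>. V \<omega> \<partial>M)"
    by (intro order_antisym upper_integral_le_integral integral_le_upper_integral V)
      (use eq in \<open>eventually_elim, simp\<close>)+
  with V eq show ?thesis by (rule that)
qed

text \<open>The excess of mass is a real number under the boundedness property; the constant sequence of
empty sets gives the lower bound. Without this, an infinite \<open>\<delta>\<^sup>+\<close> would make the subtraction in the
final inequality degenerate.\<close>

lemma delta_plus_bounds:
  assumes N: "\<And>n. n0 \<le> n \<Longrightarrow> integrable M (N n)" "\<And>n \<omega>. 0 \<le> N n \<omega>" "\<And>n. n0 \<le> n \<Longrightarrow> (\<integral>\<omega>. N n \<omega> \<partial>M) \<le> C"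
    and v: "\<And>n. n0 \<le> n \<Longrightarrow> AE \<omega> in M. v n \<omega> \<le> ereal (N n \<omega>)"
  shows "0 \<le> delta_plus M v" "delta_plus M v \<le> ereal C"
proof -
  have "upper_integral (restrict_space M {}) (v n) = 0" for n
  proof -
    have "(\<integral>\<omega>. u \<omega> \<partial>(restrict_space M {})) = 0" for u :: "'a \<Rightarrow> real"
      by (rule integral_eq_zero_AE) (simp add: AE_restrict_space_iff)
    moreover have "integrable (restrict_space M {}) (\<lambda>_. 0 :: real)"
      "AE \<omega> in restrict_space M {}. v n \<omega> \<le> ereal 0" by (simp_all add: AE_restrict_space_iff)
    ultimately have "{ereal (\<integral>\<omega>. u \<omega> \<partial>(restrict_space M {})) |u.
        integrable (restrict_space M {}) u \<and> (AE \<omega> in restrict_space M {}. v n \<omega> \<le> ereal (u \<omega>))} = {0}"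
      by (auto simp: zero_ereal_def)
    then show ?thesis unfolding upper_integral_def by simp
  qed
  then have "0 = limsup (\<lambda>k. SUP n\<in>{k..}. upper_integral (restrict_space M {}) (v n))"
    by (simp add: Limsup_const)
  also have "\<dots> \<le> delta_plus M v"
    unfolding delta_plus_def by (rule SUP_upper2[of "\<lambda>_. {}"]) auto
  finally show "0 \<le> delta_plus M v" .
  show "delta_plus M v \<le> ereal C"
    unfolding delta_plus_def
  proof (rule SUP_least)
    fix S :: "nat \<Rightarrow> 'a set"
    assume "S \<in> {S. (\<forall>k. S k \<in> sets M) \<and> decseq S \<and> (\<Inter>k. S k) \<in> null_sets M}"
    then have S: "S k \<in> sets M" for k by simp
    have *: "upper_integral (restrict_space M (S k)) (v n) \<le> ereal C" if "n0 \<le> n" for n k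
    proof -
      have Sk: "S k \<inter> space M \<in> sets M" using S by simp
      have i: "integrable M (\<lambda>\<omega>. indicator (S k) \<omega> *\<^sub>R N n \<omega>)"
        by (rule integrable_mult_indicator[OF S N(1)[OF that]])
      then have "integrable (restrict_space M (S k)) (N n)"
        using integrable_restrict_space[OF Sk] by blast
      moreover have "AE \<omega> in restrict_space M (S k). v n \<omega> \<le> ereal (N n \<omega>)"
        unfolding AE_restrict_space_iff[OF Sk] using v[OF that] by eventually_elim simp
      ultimately have "upper_integral (restrict_space M (S k)) (v n)
          \<le> ereal (\<integral>\<omega>. N n \<omega> \<partial>(restrict_space M (S k)))"
        by (rule upper_integral_le_integral)
      also have "(\<integral>\<omega>. N n \<omega> \<partial>(restrict_space M (S k))) \<le> (\<integral>\<omega>. N n \<omega> \<partial>M)"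
        unfolding integral_restrict_space[OF Sk]
        by (intro integral_mono i N(1) that) (auto simp: indicator_def N(2))
      also have "\<dots> \<le> C" by (rule N(3)[OF that])
      finally show ?thesis by simp
    qed
    show "limsup (\<lambda>k. SUP n\<in>{k..}. upper_integral (restrict_space M (S k)) (v n)) \<le> ereal C"
    proof (rule Limsup_bounded)
      show "\<forall>\<^sub>F k in sequentially. (SUP n\<in>{k..}. upper_integral (restrict_space M (S k)) (v n)) \<le> ereal C"
        using eventually_ge_at_top[of n0]
      proof eventually_elim
        case (elim k)
        show ?case by (rule SUP_least, rule *) (use elim in simp)
      qed
    qed
  qed
qed

text \<open>Along a subsequence the diagonal pairing of \<open>S i\<close> with index \<open>\<sigma> i\<close> is admissible because \<open>\<sigma> i \<ge> i\<close>,
and the supremum in \<^const>\<open>delta_plus\<close> ranges over all indices from \<open>i\<close> on.\<close>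

lemma eventually_integral_le_delta_plus:
  assumes S: "\<And>k. S k \<in> sets M" "decseq S" "(\<Inter>k. S k) \<in> null_sets M"
    and \<sigma>: "strict_mono \<sigma>"
    and V: "\<And>i. integrable M (V i)" "\<And>i. AE \<omega> in M. ereal (V i \<omega>) \<le> v (\<sigma> i) \<omega>"
    and less: "delta_plus M v < ereal b"
  shows "\<forall>\<^sub>F i in sequentially. (\<integral>\<omega>. indicator (S i) \<omega> * V i \<omega> \<partial>M) \<le> b"
proof -
  have "limsup (\<lambda>k. SUP n\<in>{k..}. upper_integral (restrict_space M (S k)) (v n)) \<le> delta_plus M v"
    unfolding delta_plus_def using S by (intro SUP_upper) auto
  with less have "\<forall>\<^sub>F k in sequentially. (SUP n\<in>{k..}. upper_integral (restrict_space M (S k)) (v n)) < ereal b"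
    by (intro Limsup_lessD) (rule le_less_trans)
  then show ?thesis
  proof eventually_elim
    case (elim k)
    have Sk: "S k \<inter> space M \<in> sets M" using S by simp
    have "integrable (restrict_space M (S k)) (V k)"
      unfolding integrable_restrict_space[OF Sk] by (rule integrable_mult_indicator[OF S(1) V(1)])
    moreover have "AE \<omega> in restrict_space M (S k). ereal (V k \<omega>) \<le> v (\<sigma> k) \<omega>"
      unfolding AE_restrict_space_iff[OF Sk] using V(2)[of k] by eventually_elim simp
    ultimately have "ereal (\<integral>\<omega>. V k \<omega> \<partial>(restrict_space M (S k)))
        \<le> upper_integral (restrict_space M (S k)) (v (\<sigma> k))"
      by (rule integral_le_upper_integral)
    also have "\<dots> \<le> (SUP n\<in>{k..}. upper_integral (restrict_space M (S k)) (v n))"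
      using seq_suble[OF \<sigma>] by (intro SUP_upper) simp
    also note elim
    finally show ?case by (simp add: integral_restrict_space[OF Sk])
  qed
qed

lemma integrable_real_representative_of_nonneg:
  assumes v: "v \<in> borel_measurable M" "\<And>\<omega>. \<omega> \<in> space M \<Longrightarrow> 0 \<le> v \<omega>"
    and C: "(\<integral>\<^sup>+\<omega>. e2ennreal (v \<omega>) \<partial>M) \<le> ennreal C" "0 \<le> C"
  obtains N where "integrable M N" "\<And>\<omega>. 0 \<le> N \<omega>" "(\<integral>\<omega>. N \<omega> \<partial>M) \<le> C" "AE \<omega> in M. v \<omega> = ereal (N \<omega>)"
proof -
  let ?N = "\<lambda>\<omega>. enn2real (e2ennreal (v \<omega>))"
  have [measurable]: "(\<lambda>\<omega>. e2ennreal (v \<omega>)) \<in> borel_measurable M" using v(1) by measurable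
  have "AE \<omega> in M. v \<omega> = ereal (?N \<omega>)"
    using integrable_enn2real(3)[OF _ C, simplified] AE_space
  proof eventually_elim
    case (elim \<omega>)
    then have "enn2ereal (e2ennreal (v \<omega>)) = enn2ereal (ennreal (?N \<omega>))" by simp
    then show ?case using v(2)[OF elim(2)] by (simp add: enn2ereal_e2ennreal)
  qed
  then show ?thesis using integrable_enn2real(1,2)[OF _ C] by (intro that[of ?N]) auto
qed

section \<open>Affine minorants and convex combinations\<close>

text \<open>An affine function \<open>\<phi> - r\<close> with \<open>r\<close> above the conjugate passes through convex combinations, so it
suffices that it is eventually dominated termwise along the sequence. The numbers \<open>Z i\<close> need not be
values of \<open>f\<close>; they may be altered as long as this domination survives for every \<open>\<phi>\<close>.\<close>

lemma biconjugate_le_liminf_convex_combinations: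
  fixes e :: "nat \<Rightarrow> 'e::real_normed_vector" and c :: "nat \<Rightarrow> nat \<Rightarrow> real"
  assumes c: "\<And>m i. i \<in> {1..k m} \<Longrightarrow> 0 \<le> c m i \<and> m \<le> j m i" "\<And>m. sum (c m) {1..k m} = 1"
    and lim: "(\<lambda>m. \<Sum>i=1..k m. c m i *\<^sub>R e (j m i)) \<longlonglongrightarrow> y"
    and Z: "\<And>\<phi> r. conjugate f \<omega> \<phi> < ereal r \<Longrightarrow> \<forall>\<^sub>F i in sequentially. blinfun_apply \<phi> (e i) - r \<le> Z i"
  shows "biconjugate f \<omega> y \<le> liminf (\<lambda>m. ereal (\<Sum>i=1..k m. c m i * Z (j m i)))"
  unfolding biconjugate_def
proof (rule SUP_least)
  fix \<phi> :: "'e \<Rightarrow>\<^sub>L real"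
  let ?W = "\<lambda>m. \<Sum>i=1..k m. c m i * Z (j m i)" and ?y = "\<lambda>m. \<Sum>i=1..k m. c m i *\<^sub>R e (j m i)"
  have key: "ereal s \<le> liminf (\<lambda>m. ereal (?W m))" if s: "ereal s < ereal (\<phi> y) - conjugate f \<omega> \<phi>" for s
  proof -
    define r where "r = \<phi> y - s"
    have "conjugate f \<omega> \<phi> < ereal r"
      using s by (cases "conjugate f \<omega> \<phi>") (auto simp: r_def)
    from Z[OF this] obtain i0 where i0: "\<And>i. i0 \<le> i \<Longrightarrow> \<phi> (e i) - r \<le> Z i"
      by (auto simp: eventually_sequentially)
    have "\<phi> (?y m) - r \<le> ?W m" if "i0 \<le> m" for m
    proof -
      have "\<phi> (?y m) - r = (\<Sum>i=1..k m. c m i * (\<phi> (e (j m i)) - r))"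
        by (simp add: blinfun.sum_right blinfun.scaleR_right right_diff_distrib sum_subtractf
            sum_distrib_right[symmetric] c(2)[simplified])
      also have "\<dots> \<le> ?W m"
        using c(1) that by (intro sum_mono mult_left_mono i0) (auto intro: order_trans)
      finally show ?thesis .
    qed
    then have "\<forall>\<^sub>F m in sequentially. ereal (\<phi> (?y m) - r) \<le> ereal (?W m)"
      by (auto simp: eventually_sequentially)
    then have "liminf (\<lambda>m. ereal (\<phi> (?y m) - r)) \<le> liminf (\<lambda>m. ereal (?W m))" by (rule Liminf_mono)
    moreover have "(\<lambda>m. ereal (\<phi> (?y m) - r)) \<longlonglongrightarrow> ereal (\<phi> y - r)"
      using lim by (intro tendsto_intros)
    then have "liminf (\<lambda>m. ereal (\<phi> (?y m) - r)) = ereal (\<phi> y - r)"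
      by (intro lim_imp_Liminf) simp_all
    ultimately show ?thesis by (simp add: r_def)
  qed
  show "ereal (\<phi> y) - conjugate f \<omega> \<phi> \<le> liminf (\<lambda>m. ereal (?W m))"
  proof (rule ccontr)
    assume "\<not> ?thesis"
    then have "liminf (\<lambda>m. ereal (?W m)) < ereal (\<phi> y) - conjugate f \<omega> \<phi>" by (simp only: not_le)
    from ereal_dense2[OF this] obtain s
      where "liminf (\<lambda>m. ereal (?W m)) < ereal s" "ereal s < ereal (\<phi> y) - conjugate f \<omega> \<phi>"
      by blast
    with key[of s] show False by simp
  qed
qed

text \<open>The termwise domination, at one point \<open>\<omega>\<close>. Where \<open>h (e i)\<close> is below a fixed level \<open>p\<close>, the points \<open>e i\<close>
stay in a weakly compact set and \<open>\<phi> (e i) - r \<le> V i\<close> holds eventually. Where it is above \<open>p\<close>, weak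
compactness of the sublevel set of \<open>h - t \<phi>\<close> shows that \<open>\<phi> (e i)\<close> is at most half of the penalty
\<open>\<eta> H i\<close> plus a constant, and the other half absorbs all constants once \<open>p\<close> is large. A very
negative \<open>V i\<close> would spoil this second case; it is compensated when it falls below \<open>- b\<close>.\<close>

lemma eventually_affine_le_penalized:
  fixes f :: "nat \<Rightarrow> 'w \<Rightarrow> 'e::{real_normed_vector, second_countable_topology} \<Rightarrow> ereal"
    and e :: "nat \<Rightarrow> 'e" and \<phi> :: "'e \<Rightarrow>\<^sub>L real"
  assumes compact: "\<And>(\<psi> :: 'e \<Rightarrow>\<^sub>L real) s :: real. compactin weak_topology {y. h y - ereal (blinfun_apply \<psi> y) \<le> ereal s}"
    and less: "conjugate (seq_weak_li f) \<omega> \<phi> < ereal r" and \<sigma>: "strict_mono \<sigma>"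
    and H: "\<And>i. h (e i) = ereal (H i)" "\<And>i. 0 \<le> H i" and V: "\<And>i. f (\<sigma> i) \<omega> (e i) = ereal (V i)"
    and \<eta>: "0 < \<eta>" and b: "0 \<le> b"
    and Z: "\<forall>\<^sub>F i in sequentially. V i + \<eta> * H i + (if b < - V i then - V i else 0) \<le> Z i"
  shows "\<forall>\<^sub>F i in sequentially. blinfun_apply \<phi> (e i) - r \<le> Z i"
proof -
  define t where "t = 2 / \<eta>"
  obtain B where B: "\<And>y. h y - ereal (blinfun_apply (t *\<^sub>R \<phi>) y) \<le> ereal 0 \<Longrightarrow> \<bar>\<phi> y\<bar> \<le> B"
    using weakly_compact_imp_bounded[OF compact[of "t *\<^sub>R \<phi>" 0], of \<phi>] by (metis mem_Collect_eq)
  have growth: "\<phi> (e i) \<le> \<eta> / 2 * H i + \<bar>B\<bar>" for i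
  proof (cases "H i \<le> t * \<phi> (e i)")
    case True
    then have "\<bar>\<phi> (e i)\<bar> \<le> B" by (intro B) (simp add: H(1) blinfun.scaleR_left)
    moreover have "0 \<le> \<eta> / 2 * H i" using \<eta> H(2) by simp
    ultimately show ?thesis by linarith
  next
    case False
    then have "\<phi> (e i) \<le> \<eta> / 2 * H i" using \<eta> by (simp add: t_def field_simps)
    then show ?thesis by simp
  qed
  \<comment> \<open>Chosen so that \<open>H i > p\<close> gives \<open>\<eta> / 2 * H i > \<bar>B\<bar> + \<bar>r\<bar> + b\<close>.\<close>
  define p where "p = t * (\<bar>B\<bar> + \<bar>r\<bar> + b)"
  \<comment> \<open>The zero functional turns the tilted sublevel sets into those of \<open>h\<close>.\<close>
  have "\<forall>\<^sub>F n in sequentially. \<forall>y\<in>{y. h y - ereal (blinfun_apply 0 y) \<le> ereal p}. ereal (\<phi> y - r) \<le> f n \<omega> y"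
    by (rule eventually_above_affine_on_weakly_compact[OF compact less])
  then have "\<forall>\<^sub>F i in sequentially. \<forall>y\<in>{y. h y \<le> ereal p}. ereal (\<phi> y - r) \<le> f (\<sigma> i) \<omega> y"
    using eventually_subseq[OF \<sigma>] by (simp add: zero_ereal_def[symmetric])
  with Z show ?thesis
  proof eventually_elim
    case (elim i)
    show ?case
    proof (cases "H i \<le> p")
      case True
      then have "ereal (\<phi> (e i) - r) \<le> f (\<sigma> i) \<omega> (e i)" using elim(2) H(1) by simp
      then have "\<phi> (e i) - r \<le> V i" using V by simp
      moreover have "0 \<le> \<eta> * H i" using \<eta> H(2) by simp
      ultimately show ?thesis using elim(1) b by (auto split: if_splits)
    next
      case False
      then have "\<bar>B\<bar> + \<bar>r\<bar> + b \<le> \<eta> / 2 * H i" using \<eta> by (simp add: p_def t_def field_simps)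
      with growth[of i] elim(1) b show ?thesis by (auto split: if_splits)
    qed
  qed
qed

section \<open>The lower semicontinuity inequality\<close>

text \<open>The lower semicontinuity inequality for a real number \<open>a\<close> above the lower limit, with the Nagumo
bound and the boundedness property replaced by real-valued representatives. The functions \<open>Z i\<close>
are the values \<open>V i\<close> of the integrands with three changes: they are set to zero on \<open>S i\<close>, which raises
the integral by at most \<open>D + \<epsilon>\<close> for large \<open>i\<close>; they are raised by the penalty \<open>\<eta> H\<close>; and off \<open>S i\<close> they are
replaced by zero where they fall below \<open>- q w\<close>. The last two cost at most \<open>\<epsilon>\<close> each, by the choice of
\<open>\<eta>\<close> and of \<open>S\<close> and \<open>q\<close>.\<close>

lemma upper_integral_biconjugate_le:
  fixes f :: "nat \<Rightarrow> 'w \<Rightarrow> 'e::{banach, second_countable_topology} \<Rightarrow> ereal"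
  assumes M: "sigma_finite_measure M"
    and f: "\<And>n. measurable_integrand M (f n)"
    and xs: "\<And>n. xs n \<in> borel_measurable M"
    and biting: "biting_converges M xs x"
    and h: "nagumo_integrand M h"
    and H: "\<And>n. integrable M (H n)" "\<And>n \<omega>. 0 \<le> H n \<omega>" "\<And>n. (\<integral>\<omega>. H n \<omega> \<partial>M) \<le> C"
      "\<And>n. AE \<omega> in M. h \<omega> (xs n \<omega>) = ereal (H n \<omega>)"
    and N: "\<And>n. \<nu> \<le> n \<Longrightarrow> integrable M (N n)" "\<And>n \<omega>. 0 \<le> N n \<omega>"
      "\<And>n. \<nu> \<le> n \<Longrightarrow> (\<integral>\<omega>. N n \<omega> \<partial>M) \<le> C"
      "\<And>n. \<nu> \<le> n \<Longrightarrow> AE \<omega> in M. - f n \<omega> (xs n \<omega>) \<le> ereal (N n \<omega>)"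
    and freq: "\<exists>\<^sub>F n in sequentially. integral_functional M (f n) (xs n) < ereal a"
    and delta: "delta_plus M (\<lambda>n \<omega>. - f n \<omega> (xs n \<omega>)) = ereal D"
  shows "integral_functional M (biconjugate (seq_weak_li f)) x \<le> ereal (a + D)"
proof -
  interpret sigma_finite_measure M by (rule M)
  have "0 \<le> (\<integral>\<omega>. H 0 \<omega> \<partial>M)" by (rule integral_nonneg_AE) (simp add: H(2))
  then have C0: "0 \<le> C" using H(3)[of 0] by simp
  obtain w :: "'w \<Rightarrow> real" where w: "integrable M w" "\<And>\<omega>. \<omega> \<in> space M \<Longrightarrow> 0 < w \<omega>"
  proof -
    obtain w' where w': "w' \<in> borel_measurable M" "integral\<^sup>N M w' \<noteq> \<infinity>"
      "\<And>\<omega>. \<omega> \<in> space M \<Longrightarrow> 0 < w' \<omega> \<and> w' \<omega> < \<infinity>"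
      using Ex_finite_integrable_function by blast
    have "integrable M (\<lambda>\<omega>. enn2real (w' \<omega>))"
      by (rule integrable_enn2real(1)[of _ _ "enn2real (integral\<^sup>N M w')"])
        (use w' in \<open>auto simp: less_top\<close>)
    then show ?thesis
      by (rule that) (use w' in \<open>auto simp: enn2real_positive_iff\<close>)
  qed
  have "\<exists>\<^sub>F n in sequentially. integral_functional M (f n) (xs n) < ereal a \<and> \<nu> \<le> n"
    using freq eventually_ge_at_top[of \<nu>] by (rule frequently_eventually_frequently)
  then obtain p where p: "strict_mono p"
    "\<And>j::nat. integral_functional M (f (p j)) (xs (p j)) < ereal a \<and> \<nu> \<le> p j"
    by (rule frequently_subsequence) metis
  have "\<exists>V. integrable M V \<and> (AE \<omega> in M. f (p j) \<omega> (xs (p j) \<omega>) = ereal (V \<omega>)) \<and> (\<integral>\<omega>. V \<omega> \<partial>M) < a" for j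
  proof -
    have m: "(\<lambda>\<omega>. f (p j) \<omega> (xs (p j) \<omega>)) \<in> borel_measurable M"
      by (rule measurable_integrand_compose[OF f xs])
    have less: "upper_integral M (\<lambda>\<omega>. f (p j) \<omega> (xs (p j) \<omega>)) < ereal a"
      using p(2)[of j] by (simp add: integral_functional_def)
    then have "upper_integral M (\<lambda>\<omega>. f (p j) \<omega> (xs (p j) \<omega>)) < \<infinity>" by (auto intro: less_trans)
    then obtain V where V: "integrable M V" "AE \<omega> in M. f (p j) \<omega> (xs (p j) \<omega>) = ereal (V \<omega>)"
      "upper_integral M (\<lambda>\<omega>. f (p j) \<omega> (xs (p j) \<omega>)) = ereal (\<integral>\<omega>. V \<omega> \<partial>M)"
      using integrable_representative[OF m N(1)[of "p j"] N(4)[of "p j"]] p(2)[of j] by blast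
    then show ?thesis using less by auto
  qed
  then obtain V' where V': "\<And>j. integrable M (V' j)"
    "\<And>j. AE \<omega> in M. f (p j) \<omega> (xs (p j) \<omega>) = ereal (V' j \<omega>)" "\<And>j. (\<integral>\<omega>. V' j \<omega> \<partial>M) < a"
    by metis
  define u' where "u' j \<omega> = max (- V' j \<omega>) 0" for j \<omega>
  have u'i: "integrable M (u' j)" for j unfolding u'_def using V'(1) by auto
  have u'0: "0 \<le> u' j \<omega>" for j \<omega> by (simp add: u'_def)
  have u'C: "(\<integral>\<omega>. u' j \<omega> \<partial>M) \<le> C" for j
  proof -
    have nu: "\<nu> \<le> p j" using p(2) by blast
    have "AE \<omega> in M. u' j \<omega> \<le> N (p j) \<omega>"
      using V'(2)[of j] N(4)[OF nu] by eventually_elim (simp add: u'_def N(2))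
    then have "(\<integral>\<omega>. u' j \<omega> \<partial>M) \<le> (\<integral>\<omega>. N (p j) \<omega> \<partial>M)"
      by (intro integral_mono_AE u'i N(1)[OF nu])
    then show ?thesis using N(3)[OF nu] by simp
  qed
  obtain r and S :: "nat \<Rightarrow> 'w set" where r: "strict_mono r"
    and S: "\<And>l. S l \<in> sets M" "decseq S" "(\<Inter>l. S l) \<in> null_sets M"
    and trunc: "\<And>\<epsilon>. 0 < \<epsilon> \<Longrightarrow> \<exists>q::nat. \<forall>\<^sub>F l in sequentially.
       (\<integral>\<omega>. indicator {\<omega> \<in> space M - S l. real q * w \<omega> < u' (r l) \<omega>} \<omega> * u' (r l) \<omega> \<partial>M) \<le> \<epsilon>"
    by (rule biting_truncation[where u = u' and C = C, OF u'i u'0 u'C w]) (assumption, rule that)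
  define \<sigma> where "\<sigma> = p \<circ> r"
  have \<sigma>: "strict_mono \<sigma>" unfolding \<sigma>_def using p(1) r by (rule strict_mono_o)
  define V where "V i = V' (r i)" for i
  define u where "u i = u' (r i)" for i
  have V: "integrable M (V i)" "AE \<omega> in M. f (\<sigma> i) \<omega> (xs (\<sigma> i) \<omega>) = ereal (V i \<omega>)" "(\<integral>\<omega>. V i \<omega> \<partial>M) < a" for i
    using V'[of "r i"] by (simp_all add: V_def \<sigma>_def)
  have u: "u i \<omega> = max (- V i \<omega>) 0" "integrable M (u i)" for i \<omega>
    using u'i by (simp_all add: u_def V_def u'_def)
  have [measurable]: "V i \<in> borel_measurable M" "u i \<in> borel_measurable M" "w \<in> borel_measurable M"
    "S i \<in> sets M" for i using V(1) u(2) w(1) S(1) by auto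
  obtain k :: "nat \<Rightarrow> nat" and c :: "nat \<Rightarrow> nat \<Rightarrow> real" and j :: "nat \<Rightarrow> nat \<Rightarrow> nat"
    where c: "\<And>m i. i \<in> {1..k m} \<Longrightarrow> 0 \<le> c m i \<and> m \<le> j m i" "\<And>m. sum (c m) {1..k m} = 1"
      and lim: "AE \<omega> in M. (\<lambda>m. \<Sum>i=1..k m. c m i *\<^sub>R (xs \<circ> \<sigma>) (j m i) \<omega>) \<longlonglongrightarrow> x \<omega>"
    by (rule biting_converges_convex_combinations[OF biting_converges_subseq[OF biting \<sigma>]]) blast
  have approx: "integral_functional M (biconjugate (seq_weak_li f)) x \<le> ereal (a + D + 3 * \<epsilon>)" if \<epsilon>: "0 < \<epsilon>" for \<epsilon>
  proof -
    obtain q :: nat where q: "\<forall>\<^sub>F l in sequentially.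
       (\<integral>\<omega>. indicator {\<omega> \<in> space M - S l. real q * w \<omega> < u l \<omega>} \<omega> * u l \<omega> \<partial>M) \<le> \<epsilon>"
      using trunc[OF \<epsilon>] unfolding u_def by blast
    \<comment> \<open>\<open>C\<close> may vanish, hence the added 1.\<close>
    define \<eta> where "\<eta> = \<epsilon> / (C + 1)"
    have \<eta>: "0 < \<eta>" "\<eta> * C \<le> \<epsilon>" using \<epsilon> C0 by (auto simp: \<eta>_def field_simps)
    define G where "G l = {\<omega> \<in> space M - S l. real q * w \<omega> < u l \<omega>}" for l
    have G[measurable]: "G l \<in> sets M" for l unfolding G_def by measurable
    define Z where "Z i \<omega> = V i \<omega> + indicator (S i) \<omega> * (- V i \<omega>) + \<eta> * H (\<sigma> i) \<omega> + indicator (G i) \<omega> * u i \<omega>" for i \<omega>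
    have int: "integrable M (\<lambda>\<omega>. indicator B \<omega> * g \<omega>)" if "B \<in> sets M" "integrable M g" for B and g :: "'w \<Rightarrow> real"
      using integrable_real_mult_indicator[OF that] by (simp add: mult.commute)
    have Vn: "integrable M (\<lambda>\<omega>. - V i \<omega>)" for i using V(1) by simp
    have Zi: "integrable M (Z i)" for i
      unfolding Z_def by (intro Bochner_Integration.integrable_add integrable_mult_right int V(1) Vn u(2) H(1) S(1) G)
    have ZI: "(\<integral>\<omega>. Z i \<omega> \<partial>M) = (\<integral>\<omega>. V i \<omega> \<partial>M) + (\<integral>\<omega>. indicator (S i) \<omega> * (- V i \<omega>) \<partial>M)
        + \<eta> * (\<integral>\<omega>. H (\<sigma> i) \<omega> \<partial>M) + (\<integral>\<omega>. indicator (G i) \<omega> * u i \<omega> \<partial>M)" for i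
      unfolding Z_def
      by (simp only: Bochner_Integration.integral_add Bochner_Integration.integrable_add integrable_mult_right
          int V(1) Vn u(2) H(1) S(1) G integral_mult_right_zero)
    have "\<forall>\<^sub>F i in sequentially. (\<integral>\<omega>. indicator (S i) \<omega> * (- V i \<omega>) \<partial>M) \<le> D + \<epsilon>"
    proof (rule eventually_integral_le_delta_plus[where V = "\<lambda>i \<omega>. - V i \<omega>", OF S \<sigma> Vn])
      show "AE \<omega> in M. ereal (- V i \<omega>) \<le> - f (\<sigma> i) \<omega> (xs (\<sigma> i) \<omega>)" for i
        using V(2)[of i] by eventually_elim simp
    qed (use delta \<epsilon> in simp)
    then have ZB: "\<forall>\<^sub>F i in sequentially. (\<integral>\<omega>. Z i \<omega> \<partial>M) \<le> a + D + 3 * \<epsilon>"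
      using q
    proof eventually_elim
      case (elim i)
      have "\<eta> * (\<integral>\<omega>. H (\<sigma> i) \<omega> \<partial>M) \<le> \<eta> * C" using H(3) \<eta>(1) by simp
      then show ?case unfolding ZI using elim V(3)[of i] \<eta>(2) by (simp add: G_def)
    qed
    \<comment> \<open>This lower bound is what Fatou's lemma needs, and \<open>w\<close> is integrable.\<close>
    have Zlow: "- (real q * w \<omega>) \<le> Z i \<omega>" if \<omega>: "\<omega> \<in> space M" for i \<omega>
    proof -
      have "0 \<le> real q * w \<omega>" using w(2)[OF \<omega>] by simp
      moreover have "0 \<le> \<eta> * H (\<sigma> i) \<omega>" using \<eta>(1) H(2) by simp
      ultimately show ?thesis using \<omega> by (auto simp: Z_def G_def u(1) indicator_def)
    qed
    have allV: "AE \<omega> in M. \<forall>i. f (\<sigma> i) \<omega> (xs (\<sigma> i) \<omega>) = ereal (V i \<omega>)"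
      using V(2) by (simp add: AE_all_countable)
    have allH: "AE \<omega> in M. \<forall>n. h \<omega> (xs n \<omega>) = ereal (H n \<omega>)"
      using H(4) by (simp add: AE_all_countable)
    have "AE \<omega> in M. biconjugate (seq_weak_li f) \<omega> (x \<omega>)
        \<le> liminf (\<lambda>m. ereal (\<Sum>i=1..k m. c m i * Z (j m i) \<omega>))"
      using allV allH lim AE_not_in[OF S(3)] AE_space
    proof eventually_elim
      case (elim \<omega>)
      show ?case
      proof (rule biconjugate_le_liminf_convex_combinations[where e = "\<lambda>i. xs (\<sigma> i) \<omega>"
              and Z = "\<lambda>i. Z i \<omega>" and k = k and c = c and j = j, OF c])
        show "(\<lambda>m. \<Sum>i=1..k m. c m i *\<^sub>R xs (\<sigma> (j m i)) \<omega>) \<longlonglongrightarrow> x \<omega>" using elim(3) by (simp add: o_def)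
        fix \<phi> :: "'e \<Rightarrow>\<^sub>L real" and s :: real
        assume less: "conjugate (seq_weak_li f) \<omega> \<phi> < ereal s"
        show "\<forall>\<^sub>F i in sequentially. \<phi> (xs (\<sigma> i) \<omega>) - s \<le> Z i \<omega>"
        proof (rule eventually_affine_le_penalized[where h = "h \<omega>" and H = "\<lambda>i. H (\<sigma> i) \<omega>"
              and V = "\<lambda>i. V i \<omega>" and b = "real q * w \<omega>", OF _ less \<sigma> _ _ _ \<eta>(1)])
          show "compactin weak_topology {y. h \<omega> y - ereal (blinfun_apply \<psi> y) \<le> ereal t}"
            for \<psi> :: "'e \<Rightarrow>\<^sub>L real" and t
            using h elim(5) unfolding nagumo_integrand_def by blast
          \<comment> \<open>Almost every point lies outside \<open>S i\<close> for all large \<open>i\<close>, where \<open>Z i\<close> is not set to zero.\<close>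
          obtain l where l: "\<omega> \<notin> S l" using elim(4) by blast
          have "V i \<omega> + \<eta> * H (\<sigma> i) \<omega> + (if real q * w \<omega> < - V i \<omega> then - V i \<omega> else 0) \<le> Z i \<omega>"
            if "l \<le> i" for i
          proof -
            have "\<omega> \<notin> S i" using l that S(2) by (auto simp: decseq_def)
            then show ?thesis using elim(5) w(2)[OF elim(5)]
              by (auto simp: Z_def G_def u(1) indicator_def)
          qed
          then show "\<forall>\<^sub>F i in sequentially. V i \<omega> + \<eta> * H (\<sigma> i) \<omega>
              + (if real q * w \<omega> < - V i \<omega> then - V i \<omega> else 0) \<le> Z i \<omega>"
            unfolding eventually_sequentially by blast
        qed (use elim w(2)[OF elim(5)] H(2) in auto)
      qed
    qed
    then show ?thesis
      unfolding integral_functional_def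
      by (intro upper_integral_le_of_convex_combinations[where Z = Z and k = k and c = c and j = j, OF Zi Zlow _ ZB c])
        (use w(1) in auto)
  qed
  show ?thesis
  proof (rule ereal_le_epsilon2)
    fix \<epsilon> :: real assume "0 < \<epsilon>"
    then show "integral_functional M (biconjugate (seq_weak_li f)) x \<le> ereal (a + D) + ereal \<epsilon>"
      using approx[of "\<epsilon> / 3"] by simp
  qed
qed

theorem theorem6p3:
  fixes M :: "'w measure"
    and f :: "nat \<Rightarrow> 'w \<Rightarrow> 'e::{banach, second_countable_topology} \<Rightarrow> ereal"
    and T :: "('w \<Rightarrow> 'e) set topology"
    and x :: "'w \<Rightarrow> 'e"
    and xs :: "nat \<Rightarrow> 'w \<Rightarrow> 'e"
  assumes "sigma_finite_measure M"
    and "complete_measure M"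
    and "\<And>n. measurable_integrand M (f n)"
    and "topspace T \<subseteq> L0 M"
    and "x \<in> borel_measurable M" and "ae_class M x \<in> topspace T"
    and "\<And>ys. \<lbrakk>\<And>n. ys n \<in> borel_measurable M; \<And>n. ae_class M (ys n) \<in> topspace T;
                limitin T (\<lambda>n. ae_class M (ys n)) (ae_class M x) sequentially\<rbrakk>
               \<Longrightarrow> biting_converges M ys x"
    and "\<And>n. xs n \<in> borel_measurable M" and "\<And>n. ae_class M (xs n) \<in> topspace T"
    and "nagumo_tight M (range xs)"
    and "limitin T (\<lambda>n. ae_class M (xs n)) (ae_class M x) sequentially"
    and "boundedness_property M f xs"
  shows "liminf (\<lambda>n. integral_functional M (f n) (xs n))
         \<ge> integral_functional M (biconjugate (seq_weak_li f)) x
           - delta_plus M (\<lambda>n \<omega>. - f n \<omega> (xs n \<omega>))"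
proof -
  note f = assms(3) and xs = assms(8)
  have biting: "biting_converges M xs x" by (rule assms(7)[OF assms(8,9,11)])
  obtain h where h: "nagumo_integrand M h" "(SUP y\<in>range xs. \<integral>\<^sup>+\<omega>. e2ennreal (h \<omega> (y \<omega>)) \<partial>M) < \<infinity>"
    using assms(10) unfolding nagumo_tight_def by blast
  obtain n0 where n0: "(SUP n\<in>{n0..}. \<integral>\<^sup>+\<omega>. e2ennreal (max (- f n \<omega> (xs n \<omega>)) 0) \<partial>M) < \<infinity>"
    using assms(12) unfolding boundedness_property_def by blast
  define C where "C = max (enn2real (SUP y\<in>range xs. \<integral>\<^sup>+\<omega>. e2ennreal (h \<omega> (y \<omega>)) \<partial>M))
    (enn2real (SUP n\<in>{n0..}. \<integral>\<^sup>+\<omega>. e2ennreal (max (- f n \<omega> (xs n \<omega>)) 0) \<partial>M))"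
  have C0: "0 \<le> C" unfolding C_def by (rule max.coboundedI1) (rule enn2real_nonneg)
  have le_C: "y \<le> ennreal C" if "y \<le> Y" "Y < \<infinity>" "enn2real Y \<le> C" for y Y
  proof -
    have "Y = ennreal (enn2real Y)" using that(2) by simp
    also have "\<dots> \<le> ennreal C" using that(3) by (rule ennreal_leI)
    finally show ?thesis using that(1) by simp
  qed
  have "\<exists>H. integrable M H \<and> (\<forall>\<omega>. 0 \<le> H \<omega>) \<and> (\<integral>\<omega>. H \<omega> \<partial>M) \<le> C \<and> (AE \<omega> in M. h \<omega> (xs n \<omega>) = ereal (H \<omega>))" for n
  proof (rule integrable_real_representative_of_nonneg[of "\<lambda>\<omega>. h \<omega> (xs n \<omega>)" M C])
    show "(\<lambda>\<omega>. h \<omega> (xs n \<omega>)) \<in> borel_measurable M"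
      using h(1) xs unfolding nagumo_integrand_def by (blast intro: measurable_integrand_compose)
    show "0 \<le> h \<omega> (xs n \<omega>)" if "\<omega> \<in> space M" for \<omega>
      using h(1) that unfolding nagumo_integrand_def by blast
    show "(\<integral>\<^sup>+\<omega>. e2ennreal (h \<omega> (xs n \<omega>)) \<partial>M) \<le> ennreal C"
      by (rule le_C[OF _ h(2)]) (auto intro!: SUP_upper simp: C_def)
  qed (use C0 in blast)+
  then obtain H where H: "\<And>n. integrable M (H n)" "\<And>n \<omega>. 0 \<le> H n \<omega>" "\<And>n. (\<integral>\<omega>. H n \<omega> \<partial>M) \<le> C"
      "\<And>n. AE \<omega> in M. h \<omega> (xs n \<omega>) = ereal (H n \<omega>)" by metis
  have "\<exists>N. (\<forall>\<omega>. 0 \<le> N \<omega>) \<and> (n0 \<le> n \<longrightarrow> integrable M N \<and> (\<integral>\<omega>. N \<omega> \<partial>M) \<le> C \<and>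
      (AE \<omega> in M. max (- f n \<omega> (xs n \<omega>)) 0 = ereal (N \<omega>)))" for n
  proof (cases "n0 \<le> n")
    case True
    show ?thesis
    proof (rule integrable_real_representative_of_nonneg[of "\<lambda>\<omega>. max (- f n \<omega> (xs n \<omega>)) 0" M C])
      show "(\<lambda>\<omega>. max (- f n \<omega> (xs n \<omega>)) 0) \<in> borel_measurable M"
        using measurable_integrand_compose[OF f xs] by measurable
      show "(\<integral>\<^sup>+\<omega>. e2ennreal (max (- f n \<omega> (xs n \<omega>)) 0) \<partial>M) \<le> ennreal C"
        by (rule le_C[OF _ n0]) (use True in \<open>auto intro!: SUP_upper simp: C_def\<close>)
    qed (use C0 in \<open>auto\<close>)
  qed (auto intro: exI[of _ "\<lambda>_. 0"])
  then obtain N where N': "\<And>n \<omega>. 0 \<le> N n \<omega>" "\<And>n. n0 \<le> n \<Longrightarrow> integrable M (N n)"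
      "\<And>n. n0 \<le> n \<Longrightarrow> (\<integral>\<omega>. N n \<omega> \<partial>M) \<le> C"
      "\<And>n. n0 \<le> n \<Longrightarrow> AE \<omega> in M. max (- f n \<omega> (xs n \<omega>)) 0 = ereal (N n \<omega>)" by metis
  have N4: "AE \<omega> in M. - f n \<omega> (xs n \<omega>) \<le> ereal (N n \<omega>)" if "n0 \<le> n" for n
    using N'(4)[OF that] by eventually_elim (metis max.cobounded1)
  let ?\<delta> = "delta_plus M (\<lambda>n \<omega>. - f n \<omega> (xs n \<omega>))"
  have "0 \<le> ?\<delta>" "?\<delta> \<le> ereal C"
    using delta_plus_bounds[of n0 M N C "\<lambda>n \<omega>. - f n \<omega> (xs n \<omega>)"] N' N4 by blast+
  then obtain D where D: "?\<delta> = ereal D" by (cases ?\<delta>) auto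
  have "integral_functional M (biconjugate (seq_weak_li f)) x - ereal D
      \<le> liminf (\<lambda>n. integral_functional M (f n) (xs n))"
  proof (rule dense_ge)
    fix A assume A: "liminf (\<lambda>n. integral_functional M (f n) (xs n)) < A"
    show "integral_functional M (biconjugate (seq_weak_li f)) x - ereal D \<le> A"
    proof (cases A)
      case (real a)
      have "\<exists>\<^sub>F n in sequentially. integral_functional M (f n) (xs n) < ereal a"
      proof (rule ccontr)
        assume "\<not> ?thesis"
        then have "\<forall>\<^sub>F n in sequentially. ereal a \<le> integral_functional M (f n) (xs n)"
          by (simp add: not_frequently not_less)
        then have "ereal a \<le> liminf (\<lambda>n. integral_functional M (f n) (xs n))" by (rule Liminf_bounded)
        then show False using A real by simp
      qed
      from upper_integral_biconjugate_le[where \<nu> = n0 and N = N, OF assms(1) f xs biting h(1) H N'(2,1,3) N4 this D]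
      show ?thesis unfolding real
        by (cases "integral_functional M (biconjugate (seq_weak_li f)) x") auto
    qed (use A in auto)
  qed
  then show ?thesis unfolding D .
qed

end
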